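(* Let $L$ be a relational language containing a binary relation symbol $<$, let $U\subseteq L\setminus\{<\}$ be a set of relation symbols of arity at least 2, and let $\mathcal K$ be the class of all finite ordered $L$-structures. Then for all $\mathbf A,\mathbf B\in\mathcal K$ there exists $\mathbf C\in\mathcal K$ such that $\mathbf C\longrightarrow_U(\mathbf B)^{\mathbf A}_2$.
   Context: An $L$-structure is ordered if $<$ is interpreted as a linear order of its vertex set. Embeddings are injective maps $f$ such that for every relation symbol $R$ and tuple $\vec x$, $\vec x\in R^{\mathbf A}$ iff $f(\vec x)\in R^{\mathbf B}$. A substructure $\mathbf A$ of $\mathbf B$ is $U$-closed if for every $R\in U$ of arity $n+1$ and every $(x_0,\dots,x_{n-1},x_n)\in R^{\mathbf B}$ with $x_0,\dots,x_{n-1}\in A$ we have $x_n\in A$. An embedding $f\colon\mathbf A\to\mathbf B$ is $U$-closed if its image $f(\mathbf A)$ is a $U$-closed substructure of $\mathbf B$; $\mathrm{Emb}(\mathbf A,\mathbf B)_U$ is the set of $U$-closed embeddings. $\mathbf C\longrightarrow_U(\mathbf B)^{\mathbf A}_2$ means: for every colouring $\chi\colon\mathrm{Emb}(\mathbf A,\mathbf C)_U\to\{0,1\}$ there is $f\in\mathrm{Emb}(\mathbf B,\mathbf C)_U$ such that $\chi$ is constant on $\{f\circ e: e\in\mathrm{Emb}(\mathbf A,\mathbf B)_U\}$. *)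

theory Defs
  imports Main "HOL-Library.FuncSet"
begin

record 'r rel_language =
  symbols :: "'r set"
  arity :: "'r \<Rightarrow> nat"

text \<open>Tuples are lists. Only the values of \<^term>\<open>rel\<close> on symbols of the language matter.\<close>

record ('v, 'r) rel_structure =
  verts :: "'v set"
  rel :: "'r \<Rightarrow> 'v list set"

definition tuples :: "'v set \<Rightarrow> nat \<Rightarrow> 'v list set" where
  "tuples V n = {xs. length xs = n \<and> set xs \<subseteq> V}"

definition L_structure :: "'r rel_language \<Rightarrow> ('v, 'r) rel_structure \<Rightarrow> bool" where
  "L_structure L M \<longleftrightarrow> (\<forall>R \<in> symbols L. rel M R \<subseteq> tuples (verts M) (arity L R))"

definition ordered_structure :: "'r \<Rightarrow> ('v, 'r) rel_structure \<Rightarrow> bool" where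
  "ordered_structure lt M \<longleftrightarrow>
     strict_linear_order_on (verts M) {(x, y). [x, y] \<in> rel M lt}"

definition finite_ordered_structures ::
    "'r rel_language \<Rightarrow> 'r \<Rightarrow> ('v, 'r) rel_structure set" where
  "finite_ordered_structures L lt =
     {M. L_structure L M \<and> finite (verts M) \<and> ordered_structure lt M}"

text \<open>Maps between vertex sets are extensional, so that each embedding is represented by
  exactly one HOL function; accordingly composition is \<^const>\<open>compose\<close>.\<close>

definition Emb :: "'r rel_language \<Rightarrow> ('v, 'r) rel_structure \<Rightarrow> ('w, 'r) rel_structure
    \<Rightarrow> ('v \<Rightarrow> 'w) set" where
  "Emb L A B = {f \<in> verts A \<rightarrow>\<^sub>E verts B. inj_on f (verts A) \<and>
     (\<forall>R \<in> symbols L. \<forall>xs \<in> tuples (verts A) (arity L R).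
        xs \<in> rel A R \<longleftrightarrow> map f xs \<in> rel B R)}"

definition substructure ::
    "'r rel_language \<Rightarrow> ('v, 'r) rel_structure \<Rightarrow> ('v, 'r) rel_structure \<Rightarrow> bool" where
  "substructure L A B \<longleftrightarrow> verts A \<subseteq> verts B \<and>
     (\<forall>R \<in> symbols L. rel A R = rel B R \<inter> tuples (verts A) (arity L R))"

definition U_closed_substructure :: "'r rel_language \<Rightarrow> 'r set
    \<Rightarrow> ('v, 'r) rel_structure \<Rightarrow> ('v, 'r) rel_structure \<Rightarrow> bool" where
  "U_closed_substructure L U A B \<longleftrightarrow> substructure L A B \<and>
     (\<forall>R \<in> U. \<forall>xs y. xs @ [y] \<in> rel B R \<longrightarrow> set xs \<subseteq> verts A \<longrightarrow> y \<in> verts A)"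

definition image_structure ::
    "('v \<Rightarrow> 'w) \<Rightarrow> ('v, 'r) rel_structure \<Rightarrow> ('w, 'r) rel_structure" where
  "image_structure f A = \<lparr>verts = f ` verts A, rel = (\<lambda>R. map f ` rel A R)\<rparr>"

definition Emb_U :: "'r rel_language \<Rightarrow> 'r set \<Rightarrow> ('v, 'r) rel_structure
    \<Rightarrow> ('w, 'r) rel_structure \<Rightarrow> ('v \<Rightarrow> 'w) set" where
  "Emb_U L U A B = {f \<in> Emb L A B. U_closed_substructure L U (image_structure f A) B}"

definition U_arrow :: "'r rel_language \<Rightarrow> 'r set \<Rightarrow> ('c, 'r) rel_structure
    \<Rightarrow> ('b, 'r) rel_structure \<Rightarrow> ('a, 'r) rel_structure \<Rightarrow> bool" where
  "U_arrow L U C B A \<longleftrightarrow>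
     (\<forall>\<chi> \<in> Emb_U L U A C \<rightarrow> {0, 1::nat}. \<exists>f \<in> Emb_U L U B C. \<exists>c.
        \<forall>e \<in> Emb_U L U A B. \<chi> (compose (verts A) f e) = c)"

end

theory Submission
  imports Defs "HOL-Library.Ramsey"
begin

text \<open>
  A partite construction over the order \<open>{..<N}\<close>, where \<open>N\<close> is a Ramsey number for \<open>card B\<close> and
  \<open>card A\<close>. One starts with disjoint copies of \<open>B\<close>, one for each increasing map \<open>B \<rightarrow> {..<N}\<close>, and
  makes the colour of the closed copies of \<open>A\<close> lying over a given increasing map \<open>\<alpha>\<close> constant,
  for one \<open>\<alpha>\<close> after the other. In the step for \<open>\<alpha>\<close>, the closed copies of \<open>A\<close> over \<open>\<alpha>\<close> in the
  current structure \<open>P\<close> are the letters of a Hales--Jewett alphabet; each combinatorial line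
  gives a copy of \<open>P\<close>, and these copies are glued along the points of the Hales--Jewett cube.

  With all lines, the copies of \<open>P\<close> need not be closed, because two lines with the same
  active set may share vertices whose closure leaves the closed copies of \<open>A\<close>. So one uses a
  family of lines that still has the Hales--Jewett property but in which distinct lines have
  distinct active sets. Two copies of \<open>P\<close> then meet only inside closed copies of \<open>A\<close>, and every
  copy is closed in the amalgam. Such a family is itself obtained by a partite construction
  over an ordinary Hales--Jewett cube.
\<close>

subsection \<open>The Hales--Jewett theorem\<close>

definition words :: "'a set \<Rightarrow> nat \<Rightarrow> 'a list set" where
  "words X n = {w. set w \<subseteq> X \<and> length w = n}"

text \<open>A line is a word with holes: \<open>None\<close> marks an active coordinate,
  \<open>Some a\<close> a fixed one.\<close>

definition lines :: "'a set \<Rightarrow> nat \<Rightarrow> 'a option list set" where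
  "lines X n = {W. length W = n \<and> set W \<subseteq> insert None (Some ` X) \<and> None \<in> set W}"

definition plug :: "'a option list \<Rightarrow> 'a \<Rightarrow> 'a list" where
  "plug W a = map (case_option a id) W"

definition hj_number :: "'a set \<Rightarrow> nat \<Rightarrow> nat \<Rightarrow> bool" where
  "hj_number X k n \<longleftrightarrow>
     (\<forall>\<chi> \<in> words X n \<rightarrow> {..<k}. \<exists>W \<in> lines X n. \<exists>c. \<forall>a \<in> X. \<chi> (plug W a) = c)"

lemma length_plug [simp]: "length (plug W a) = length W"
  by (simp add: plug_def)

lemma plug_append: "plug (W @ W') a = plug W a @ plug W' a"
  by (simp add: plug_def)

lemma plug_map_Some [simp]: "plug (map Some w) a = w"
  by (simp add: plug_def comp_def)

lemma take_plug: "take n (plug W a) = plug (take n W) a"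
  by (simp add: plug_def take_map)

lemma plug_in_words:
  assumes "W \<in> lines X n" "a \<in> X" shows "plug W a \<in> words X n"
  using assms by (fastforce simp: lines_def words_def plug_def split: option.splits)

lemma append_in_words:
  "u \<in> words X m \<Longrightarrow> v \<in> words X n \<Longrightarrow> u @ v \<in> words X (m + n)"
  by (auto simp: words_def)

lemma lines_append:
  assumes "W \<in> lines X m" "W' \<in> lines X n" shows "W @ W' \<in> lines X (m + n)"
  using assms by (auto simp: lines_def)

lemma lines_append_word:
  assumes "W \<in> lines X m" "w \<in> words X n" shows "W @ map Some w \<in> lines X (m + n)"
  using assms by (auto simp: lines_def words_def)

lemma word_append_lines:
  assumes "w \<in> words X m" "W \<in> lines X n" shows "map Some w @ W \<in> lines X (m + n)"
  using assms by (auto simp: lines_def words_def)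

lemma lines_mono: "X \<subseteq> Y \<Longrightarrow> lines X n \<subseteq> lines Y n"
  by (auto simp: lines_def)

lemma finite_words: "finite X \<Longrightarrow> finite (words X n)"
  unfolding words_def by (rule finite_lists_length_eq)

lemma finite_lines: "finite X \<Longrightarrow> finite (lines X n)"
  by (rule finite_subset[OF _ finite_words[of "insert None (Some ` X)" n]])
    (auto simp: lines_def words_def)

lemma hj_numberE:
  assumes "hj_number X k n" "\<And>w. w \<in> words X n \<Longrightarrow> \<chi> w < k"
  obtains W c where "W \<in> lines X n" "\<And>a. a \<in> X \<Longrightarrow> \<chi> (plug W a) = c"
proof -
  have "\<chi> \<in> words X n \<rightarrow> {..<k}" using assms(2) by blast
  then show ?thesis using assms(1) that unfolding hj_number_def by blast
qed

text \<open>In the focusing induction a colour is a whole function on words, so an arbitrary finite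
  set of colours must be allowed. A bijection with \<open>{..<card K}\<close> reduces this to
  numbers.\<close>

lemma hj_number_finite_colours:
  assumes "hj_number X (card K) n" "finite K" "\<chi> \<in> words X n \<rightarrow> K"
  obtains W c where "W \<in> lines X n" "\<And>a. a \<in> X \<Longrightarrow> \<chi> (plug W a) = c"
proof -
  obtain f where f: "bij_betw f K {..<card K}"
    using ex_bij_betw_finite_nat[OF assms(2)] atLeast0LessThan by metis
  then have "f \<circ> \<chi> \<in> words X n \<rightarrow> {..<card K}"
    using assms(3) bij_betwE[OF f] by fastforce
  then obtain W c where W: "W \<in> lines X n" "\<And>a. a \<in> X \<Longrightarrow> f (\<chi> (plug W a)) = c"
    using assms(1) unfolding hj_number_def by fastforce
  have "\<chi> (plug W a) = inv_into K f c" if "a \<in> X" for a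
    using W(2)[OF that] plug_in_words[OF W(1) that] assms(3) f
    by (metis Pi_mem bij_betw_imp_inj_on inv_into_f_f)
  then show ?thesis using W(1) that by blast
qed

text \<open>Colour focusing: all lines of the second alternative meet in the point \<open>f\<close>, and the
  colours \<open>C\<close> of their remaining points are pairwise distinct.\<close>

lemma colour_focusing:
  fixes k :: nat
  assumes IH: "\<And>k. \<exists>n. hj_number X k n" and X: "finite X" "a0 \<in> X"
  shows "\<exists>n. \<forall>\<chi> \<in> words (insert z X) n \<rightarrow> {..<k}.
    (\<exists>W \<in> lines (insert z X) n. \<exists>c. \<forall>a \<in> insert z X. \<chi> (plug W a) = c) \<or>
    (\<exists>f \<in> words (insert z X) n. \<exists>C. C \<subseteq> {..<k} \<and> card C = r \<and>
      (\<forall>c \<in> C. \<exists>W \<in> lines (insert z X) n. plug W z = f \<and> (\<forall>a \<in> X. \<chi> (plug W a) = c)))"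
    (is "\<exists>n. \<forall>\<chi> \<in> _. ?mono n \<chi> \<or> ?foc r n \<chi>")
proof (induction r)
  case 0
  have "?foc 0 0 \<chi>" for \<chi> :: "'a list \<Rightarrow> nat"
    by (intro bexI[of _ "[]"] exI[of _ "{}"]) (auto simp: words_def)
  then show ?case by blast
next
  case (Suc r)
  let ?Y = "insert z X"
  obtain n where n: "\<And>\<chi>. \<chi> \<in> words ?Y n \<rightarrow> {..<k} \<Longrightarrow> ?mono n \<chi> \<or> ?foc r n \<chi>"
    using Suc by blast
  \<comment> \<open>A suffix \<open>v\<close> over \<open>X\<close> is coloured by the function
    sending \<open>u\<close> to \<open>\<chi> (u @ v)\<close>. Along a line \<open>V\<close>
    monochromatic for this, no prefix \<open>u\<close> notices which letter of \<open>X\<close> is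
    plugged in.\<close>
  let ?K = "words ?Y n \<rightarrow>\<^sub>E {..<k}"
  have finK: "finite ?K" using X by (simp add: finite_PiE finite_words)
  obtain m where m: "hj_number X (card ?K) m" using IH by blast
  have "?mono (n + m) \<chi> \<or> ?foc (Suc r) (n + m) \<chi>"
    if \<chi>: "\<chi> \<in> words ?Y (n + m) \<rightarrow> {..<k}" for \<chi>
  proof -
    have wm: "words X m \<subseteq> words ?Y m" by (auto simp: words_def)
    have "\<chi> (u @ v) < k" if "u \<in> words ?Y n" "v \<in> words X m" for u v
      using Pi_mem[OF \<chi> append_in_words[OF that(1)]] that(2) wm by blast
    then have "(\<lambda>v. \<lambda>u \<in> words ?Y n. \<chi> (u @ v)) \<in> words X m \<rightarrow> ?K"
      by auto
    from hj_number_finite_colours[OF m finK this]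
    obtain V g where V: "V \<in> lines X m"
      and g: "\<And>a. a \<in> X \<Longrightarrow> (\<lambda>u \<in> words ?Y n. \<chi> (u @ plug V a)) = g" by metis
    have V_indep: "\<chi> (u @ plug V a) = \<chi> (u @ plug V a0)" if "a \<in> X" "u \<in> words ?Y n" for a u
      using g[OF that(1)] g[OF X(2)] that(2) by (metis restrict_apply')
    have V': "V \<in> lines ?Y m" using V lines_mono[of X ?Y] by blast
    \<comment> \<open>By \<open>V_indep\<close> every letter of \<open>X\<close> in place of
      \<open>a0\<close> gives the same colouring of prefixes.\<close>
    define \<chi>' where "\<chi>' = (\<lambda>u. \<chi> (u @ plug V a0))"
    have pa0: "plug V a0 \<in> words ?Y m" using plug_in_words[OF V X(2)] wm by blast
    have \<chi>': "\<chi>' u < k" if "u \<in> words ?Y n" for u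
      using Pi_mem[OF \<chi> append_in_words[OF that pa0]] by (simp add: \<chi>'_def)
    then have "\<chi>' \<in> words ?Y n \<rightarrow> {..<k}" by blast
    from n[OF this] have "?mono n \<chi>' \<or> ?foc r n \<chi>'" .
    moreover have ?thesis if "?mono n \<chi>'"
    proof -
      from that obtain W c where W: "W \<in> lines ?Y n" "\<forall>a \<in> ?Y. \<chi>' (plug W a) = c" by blast
      have "W @ map Some (plug V a0) \<in> lines ?Y (n + m)" by (rule lines_append_word[OF W(1) pa0])
      moreover have "\<forall>a \<in> ?Y. \<chi> (plug (W @ map Some (plug V a0)) a) = c"
        using W by (simp add: plug_append \<chi>'_def)
      ultimately show ?thesis by blast
    qed
    moreover have "?mono n \<chi>' \<or> ?thesis" if "?foc r n \<chi>'"
    proof -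
      from that obtain f C where f: "f \<in> words ?Y n" and C: "C \<subseteq> {..<k}" "card C = r"
        and WC: "\<And>c. c \<in> C \<Longrightarrow>
          \<exists>W \<in> lines ?Y n. plug W z = f \<and> (\<forall>a \<in> X. \<chi>' (plug W a) = c)" by blast
      show ?thesis
      \<comment> \<open>If the focus has a colour in \<open>C\<close>, the line of that colour is
        monochromatic at \<open>z\<close> as well, and the case \<open>?mono n \<chi>'\<close>
        applies.\<close>
      proof (cases "\<chi>' f \<in> C")
        case True
        then show ?thesis using WC by fastforce
      next
        case False
        \<comment> \<open>The old lines move along with \<open>V\<close> and keep their colours on
          \<open>X\<close>. The new line is \<open>map Some f @ V\<close>, with the colour
          \<open>\<chi>' f\<close> missing from \<open>C\<close>. All of them pass through
          \<open>?f\<close> at the letter \<open>z\<close>.\<close>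
        let ?f = "f @ plug V z" and ?C = "insert (\<chi>' f) C"
        have f': "?f \<in> words ?Y (n + m)"
          by (rule append_in_words[OF f plug_in_words[OF V' insertI1]])
        have C': "?C \<subseteq> {..<k}"
          using C \<chi>'[OF f] by auto
        have "card ?C = Suc r"
          using C False finite_subset[OF C(1)] by simp
        moreover have "\<exists>W \<in> lines ?Y (n + m). plug W z = ?f \<and> (\<forall>a \<in> X. \<chi> (plug W a) = c)"
          if c: "c \<in> ?C" for c
        proof (cases "c = \<chi>' f")
          case True
          then show ?thesis
            using word_append_lines[OF f V'] V_indep f
            by (intro bexI[of _ "map Some f @ V"]) (auto simp: plug_append \<chi>'_def)
        next
          case False
          with c WC obtain W where W: "W \<in> lines ?Y n" "plug W z = f"
            "\<forall>a \<in> X. \<chi>' (plug W a) = c" by blast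
          have "\<chi> (plug (W @ V) a) = c" if "a \<in> X" for a
            using V_indep[OF that] plug_in_words[OF W(1)] W(3) that
            by (simp add: plug_append \<chi>'_def)
          then show ?thesis
            using lines_append[OF W(1) V'] W(2)
            by (intro bexI[of _ "W @ V"]) (auto simp: plug_append)
        qed
        ultimately show ?thesis using f' C' by blast
      qed
    qed
    ultimately show ?thesis by blast
  qed
  then show ?case by blast
qed

text \<open>Letters are added one at a time. With \<open>r = k\<close> the focused lines exhaust the
  colours, so the focus has the colour of one of them, and that line is monochromatic at the new
  letter too.\<close>

theorem hales_jewett:
  assumes "finite X" shows "\<exists>n. hj_number X k n"
  using assms
proof (induction X arbitrary: k rule: finite_induct)
  case empty
  have "[None] \<in> lines {} 1" by (simp add: lines_def)
  then show ?case unfolding hj_number_def by blast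
next
  case (insert z X)
  show ?case
  proof (cases "X = {}")
    case True
    have "[None] \<in> lines {z} 1" by (simp add: lines_def)
    with True show ?thesis unfolding hj_number_def by blast
  next
    case False
    then obtain a0 where "a0 \<in> X" by blast
    from colour_focusing[OF insert.IH insert.hyps(1) this, of z k k]
    obtain n where n: "\<And>\<chi>. \<chi> \<in> words (insert z X) n \<rightarrow> {..<k} \<Longrightarrow>
      (\<exists>W \<in> lines (insert z X) n. \<exists>c. \<forall>a \<in> insert z X. \<chi> (plug W a) = c) \<or>
      (\<exists>f \<in> words (insert z X) n. \<exists>C. C \<subseteq> {..<k} \<and> card C = k \<and>
        (\<forall>c \<in> C. \<exists>W \<in> lines (insert z X) n. plug W z = f \<and> (\<forall>a \<in> X. \<chi> (plug W a) = c)))"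
      by blast
    have "\<exists>W \<in> lines (insert z X) n. \<exists>c. \<forall>a \<in> insert z X. \<chi> (plug W a) = c"
      if \<chi>: "\<chi> \<in> words (insert z X) n \<rightarrow> {..<k}" for \<chi>
      using n[OF \<chi>]
    proof (elim disjE bexE exE conjE)
      fix f C
      assume f: "f \<in> words (insert z X) n" and C: "C \<subseteq> {..<k}" "card C = k"
        and WC: "\<forall>c \<in> C. \<exists>W \<in> lines (insert z X) n.
          plug W z = f \<and> (\<forall>a \<in> X. \<chi> (plug W a) = c)"
      have "C = {..<k}" using C by (simp add: card_subset_eq)
      with f \<chi> have "\<chi> f \<in> C" by auto
      then show ?thesis using WC by fastforce
    qed blast
    then show ?thesis unfolding hj_number_def by blast
  qed
qed

subsection \<open>Lines with distinct active sets\<close>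

definition active :: "'a option list \<Rightarrow> bool list" where
  "active W = map (\<lambda>s. s = None) W"

text \<open>Points of the lines of \<open>\<L>\<close> project to \<open>words X N\<close> by taking the first \<open>N\<close> letters.\<close>

definition sparse_family :: "'a set \<Rightarrow> nat \<Rightarrow> nat \<Rightarrow> 'a option list set \<Rightarrow> bool" where
  "sparse_family X N n \<L> \<longleftrightarrow>
     \<L> \<subseteq> lines X n \<and> inj_on active \<L> \<and> (\<forall>W \<in> \<L>. take N W \<in> lines X N)"

lemma plug_concat: "plug (concat Ws) a = concat (map (\<lambda>W. plug W a) Ws)"
  by (simp add: plug_def map_concat)

lemma active_append: "active (W @ W') = active W @ active W'"
  by (simp add: active_def)

lemma active_concat: "active (concat Ws) = concat (map active Ws)"
  by (simp add: active_def[abs_def] map_concat)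

lemma length_active [simp]: "length (active W) = length W"
  by (simp add: active_def)

lemma True_in_active: "True \<in> set (active W) \<longleftrightarrow> None \<in> set W"
  by (force simp: active_def)

lemma concat_map_eqD:
  assumes "concat (map f xs) = concat (map g xs)" "\<And>x. x \<in> set xs \<Longrightarrow> length (f x) = length (g x)"
    "x \<in> set xs"
  shows "f x = g x"
  using assms by (induction xs) auto

lemma length_concat_const:
  "(\<And>xs. xs \<in> set xss \<Longrightarrow> length xs = n) \<Longrightarrow> length (concat xss) = length xss * n"
  by (induction xss) auto

text \<open>Hales--Jewett is applied to the points over \<open>x\<close> as letters. In the new word, the coordinates in
  \<open>marks\<close> are constant on the points over \<open>x\<close>, so these points still depend only on a Hales--Jewett
  word, but on every line they have an active position in the block indexed by \<open>V\<close>; thus the active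
  set determines \<open>V\<close>.\<close>

lemma sparse_family_step:
  fixes k :: nat
  assumes X: "finite X" and fam: "sparse_family X N n \<L>" and x: "x \<in> words X N"
  shows "\<exists>n' \<L>'. sparse_family X N n' \<L>' \<and> (\<forall>\<chi> \<in> words X n' \<rightarrow> {..<k}. \<exists>e \<psi> c.
    (\<forall>W \<in> \<L>. e W \<in> \<L>' \<and> take N (e W) = take N W \<and>
      (\<forall>a \<in> X. plug (e W) a = \<psi> (plug W a))) \<and>
    (\<forall>W \<in> \<L>. \<forall>a \<in> X. take N (plug W a) = x \<longrightarrow> \<chi> (\<psi> (plug W a)) = c))"
proof -
  have fam_lines: "\<And>W. W \<in> \<L> \<Longrightarrow> W \<in> lines X n"
    and fam_take: "\<And>W. W \<in> \<L> \<Longrightarrow> take N W \<in> lines X N"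
    and fam_inj: "inj_on active \<L>"
    using fam by (auto simp: sparse_family_def)
  define \<Gamma> where "\<Gamma> = {q \<in> words X n. take N q = x}"
  have "finite \<Gamma>" using finite_words[OF X] unfolding \<Gamma>_def by simp
  from hales_jewett[OF this, of k] obtain M where M: "hj_number \<Gamma> k M" by blast
  obtain vs where vs: "set vs = lines \<Gamma> M"
    using finite_list[OF finite_lines[OF \<open>finite \<Gamma>\<close>]] by blast
  \<comment> \<open>An active letter of \<open>V\<close> becomes the line \<open>W\<close> itself
    and a fixed letter \<open>q\<close> the constant word \<open>q\<close>, so plugging in
    \<open>a\<close> yields the concatenation of \<open>plug V (plug W a)\<close>.\<close>
  define blocks where "blocks = (\<lambda>V W :: 'a option list. concat (map (case_option W (map Some)) V))"
  define marks where "marks = (\<lambda>V W. concat (map (\<lambda>V'. if V' = V then W else map Some x) vs))"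
  define e where "e = (\<lambda>V W. take N W @ blocks V W @ marks V (take N W))"
  \<comment> \<open>\<open>\<psi> V\<close> acts on points rather than on lines, so a point common
    to two lines of \<open>\<L>\<close> stays common to their images under
    \<open>e V\<close>.\<close>
  define \<psi> where "\<psi> = (\<lambda>V q. take N q @ concat (plug V q) @
    concat (map (\<lambda>V'. if V' = V then take N q else x) vs))"
  define n' where "n' = N + (M * n + length vs * N)"
  define \<L>' where "\<L>' = {e V W | V W. V \<in> lines \<Gamma> M \<and> W \<in> \<L>}"
  have len_x: "length x = N" and set_x: "set x \<subseteq> X" using x by (auto simp: words_def)
  have len_W: "length W = n" "length (take N W) = N" if "W \<in> \<L>" for W
    using fam_lines[OF that] fam_take[OF that] by (auto simp: lines_def)
  have len_blocks: "length (blocks V W) = M * n" if "V \<in> lines \<Gamma> M" "W \<in> \<L>" for V W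
  proof -
    have "length (blocks V W) = length (map (case_option W (map Some)) V) * n"
      unfolding blocks_def
      by (rule length_concat_const)
        (use that len_W in \<open>fastforce simp: lines_def \<Gamma>_def words_def split: option.splits\<close>)
    then show ?thesis using that by (simp add: lines_def)
  qed
  have len_marks: "length (marks V (take N W)) = length vs * N" if "W \<in> \<L>" for V W
    unfolding marks_def using length_concat_const[of "map _ vs" N] len_W[OF that] len_x
    by (subst length_concat_const[where n = N]) auto
  have e_lines: "e V W \<in> lines X n'" if "V \<in> lines \<Gamma> M" "W \<in> \<L>" for V W
  proof -
    have "set (blocks V W) \<subseteq> insert None (Some ` X)"
      using that fam_lines[OF that(2)]
      by (fastforce simp: blocks_def lines_def \<Gamma>_def words_def split: option.splits)
    moreover have "set (marks V (take N W)) \<subseteq> insert None (Some ` X)"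
      using fam_take[OF that(2)] set_x by (auto simp: marks_def lines_def split: if_splits)
    ultimately show ?thesis
      using fam_take[OF that(2)] len_blocks[OF that] len_marks[OF that(2)] len_W[OF that(2)]
      by (auto simp: e_def lines_def n'_def)
  qed
  have take_e: "take N (e V W) = take N W" if "W \<in> \<L>" for V W
    using len_W[OF that] by (simp add: e_def)
  have plug_e: "plug (e V W) a = \<psi> V (plug W a)" for V W a
  proof -
    have "plug (blocks V W) a = concat (plug V (plug W a))"
      unfolding blocks_def plug_concat plug_def[of V]
      by (auto intro!: arg_cong[of _ _ concat] split: option.splits)
    moreover have "plug (marks V (take N W)) a =
      concat (map (\<lambda>V'. if V' = V then take N (plug W a) else x) vs)"
      unfolding marks_def plug_concat by (auto intro!: arg_cong[of _ _ concat] simp: take_plug)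
    ultimately show ?thesis by (simp add: e_def \<psi>_def plug_append take_plug)
  qed
  have e_inj: "V = V' \<and> W = W'"
    if V: "V \<in> lines \<Gamma> M" "V' \<in> lines \<Gamma> M" and W: "W \<in> \<L>" "W' \<in> \<L>"
      and eq: "active (e V W) = active (e V' W')" for V V' W W'
  proof -
    have eqb: "active (blocks V W) = active (blocks V' W')"
      and eqm: "active (marks V (take N W)) = active (marks V' (take N W'))"
      using eq len_W[OF W(1)] len_W[OF W(2)] len_blocks V W by (auto simp: e_def active_append)
    \<comment> \<open>At the block indexed by \<open>V\<close>, \<open>marks V\<close> contains the
      line \<open>take N W\<close>, while \<open>marks V'\<close> with \<open>V' \<noteq> V\<close>
      has only fixed letters there.\<close>
    have "active (if V = V then take N W else map Some x) =
      active (if V = V' then take N W' else map Some x)"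
      using eqm V(1) len_W[OF W(1)] len_W[OF W(2)] len_x
      by (intro concat_map_eqD[of "\<lambda>V''. active (if V'' = V then take N W else map Some x)" vs
            "\<lambda>V''. active (if V'' = V' then take N W' else map Some x)"])
        (auto simp: marks_def active_concat comp_def vs)
    then have VV: "V = V'"
      using fam_take[OF W(1)] True_in_active[of "take N W"] True_in_active[of "map Some x"]
      by (auto simp: lines_def split: if_splits)
    \<comment> \<open>At an active coordinate of \<open>V\<close> the block is \<open>W\<close>, so
      the active set of \<open>W\<close> can be read off.\<close>
    have None: "None \<in> set V" using V by (simp add: lines_def)
    have "active (case_option W (map Some) None) = active (case_option W' (map Some) None)"
      by (rule concat_map_eqD[of "\<lambda>s. active (case_option W (map Some) s)" V
            "\<lambda>s. active (case_option W' (map Some) s)", OF _ _ None])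
        (use eqb VV W len_W in \<open>auto simp: blocks_def active_concat comp_def split: option.splits\<close>)
    then have "W = W'" using fam_inj W by (simp add: inj_on_def)
    with VV show ?thesis by simp
  qed
  have "sparse_family X N n' \<L>'"
    unfolding sparse_family_def
  proof (intro conjI ballI)
    show "\<L>' \<subseteq> lines X n'" using e_lines by (auto simp: \<L>'_def)
    show "inj_on active \<L>'" unfolding inj_on_def \<L>'_def using e_inj by blast
    show "take N W \<in> lines X N" if "W \<in> \<L>'" for W
      using that take_e fam_take by (auto simp: \<L>'_def)
  qed
  moreover have "\<exists>e \<psi> c. (\<forall>W \<in> \<L>. e W \<in> \<L>' \<and> take N (e W) = take N W \<and>
      (\<forall>a \<in> X. plug (e W) a = \<psi> (plug W a))) \<and>
    (\<forall>W \<in> \<L>. \<forall>a \<in> X. take N (plug W a) = x \<longrightarrow> \<chi> (\<psi> (plug W a)) = c)"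
    if \<chi>: "\<chi> \<in> words X n' \<rightarrow> {..<k}" for \<chi>
  proof -
    \<comment> \<open>Over \<open>x\<close> all marks equal \<open>x\<close> for every
      \<open>V\<close>. Hence the colouring can be pulled back to words over \<open>\<Gamma>\<close>
      before \<open>V\<close> is chosen.\<close>
    let ?w = "\<lambda>u. x @ concat u @ concat (map (\<lambda>_. x) vs)"
    have "?w u \<in> words X n'" if "u \<in> words \<Gamma> M" for u
    proof -
      have "length (concat u) = length u * n"
        by (rule length_concat_const) (use that in \<open>auto simp: words_def \<Gamma>_def\<close>)
      moreover have "length (concat (map (\<lambda>_. x) vs)) = length vs * N"
        by (subst length_concat_const[where n = N]) (auto simp: len_x)
      ultimately show ?thesis
        using that set_x len_x by (fastforce simp: words_def \<Gamma>_def n'_def)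
    qed
    moreover define \<xi> where "\<xi> = (\<lambda>u. \<chi> (?w u))"
    ultimately have "\<xi> u < k" if "u \<in> words \<Gamma> M" for u using Pi_mem[OF \<chi>] that by simp
    from hj_numberE[OF M, of \<xi>, OF this]
    obtain V c where V: "V \<in> lines \<Gamma> M" and c: "\<And>q. q \<in> \<Gamma> \<Longrightarrow> \<xi> (plug V q) = c" by blast
    have "\<chi> (\<psi> V (plug W a)) = c" if "W \<in> \<L>" "a \<in> X" "take N (plug W a) = x" for W a
    proof -
      have "plug W a \<in> \<Gamma>" using that plug_in_words[OF fam_lines] by (simp add: \<Gamma>_def)
      moreover have "\<psi> V (plug W a) = ?w (plug V (plug W a))"
        unfolding \<psi>_def that(3) by simp
      ultimately show ?thesis using c by (simp add: \<xi>_def)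
    qed
    then show ?thesis
      using V take_e plug_e by (intro exI[of _ "e V"] exI[of _ "\<psi> V"] exI[of _ c]) (auto simp: \<L>'_def)
  qed
  ultimately show ?thesis by blast
qed

text \<open>Extra coordinates indexed by the lines, active only at the line itself, separate the
  active sets and leave the first \<open>N\<close> letters unchanged.\<close>

lemma sparse_family_exists:
  assumes X: "finite X" "a0 \<in> X"
  shows "\<exists>n \<L>. sparse_family X N n \<L> \<and> (\<forall>W \<in> lines X N. \<exists>W' \<in> \<L>. take N W' = W)"
proof -
  obtain ls where ls: "set ls = lines X N" using finite_list[OF finite_lines[OF X(1)]] by blast
  define e where "e = (\<lambda>W. W @ map (\<lambda>W'. if W' = W then None else Some a0) ls)"
  have "e W \<in> lines X (N + length ls)" if "W \<in> lines X N" for W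
    using that X by (auto simp: lines_def e_def)
  moreover have "take N (e W) = W" if "W \<in> lines X N" for W
    using that by (simp add: lines_def e_def)
  moreover have "inj_on active (e ` lines X N)"
  proof -
    have "W = W'" if W: "W \<in> lines X N" "W' \<in> lines X N" and eq: "active (e W) = active (e W')" for W W'
    proof -
      have "active (map (\<lambda>W'. if W' = W then None else Some a0) ls) = map (\<lambda>V. V = W) ls" for W
        by (simp add: active_def)
      then have "map (\<lambda>V. V = W) ls = map (\<lambda>V. V = W') ls"
        using eq W by (simp add: active_append e_def lines_def)
      then show ?thesis using W ls by (auto simp: map_eq_conv)
    qed
    then show ?thesis by (auto simp: inj_on_def)
  qed
  ultimately show ?thesis
    by (intro exI[of _ "N + length ls"] exI[of _ "e ` lines X N"]) (auto simp: sparse_family_def)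
qed

text \<open>One application of \<open>sparse_family_step\<close> for each word of \<open>S\<close>.
  The newest step is applied to \<open>\<chi>\<close> first, and the induction hypothesis then to
  the colouring pulled back along \<open>\<psi>\<close>.\<close>

lemma sparse_family_iterate:
  fixes k :: nat
  assumes X: "finite X" "a0 \<in> X" and S: "finite S" "S \<subseteq> words X N"
  shows "\<exists>n \<L>. sparse_family X N n \<L> \<and> (\<forall>\<chi> \<in> words X n \<rightarrow> {..<k}. \<exists>\<phi> c.
    (\<forall>W \<in> lines X N. \<phi> W \<in> \<L> \<and> take N (\<phi> W) = W \<and>
      (\<forall>a \<in> X. plug W a \<in> S \<longrightarrow> \<chi> (plug (\<phi> W) a) = c (plug W a))))"
  using S
proof (induction S rule: finite_induct)
  case empty
  obtain n \<L> where "sparse_family X N n \<L>" "\<forall>W \<in> lines X N. \<exists>W' \<in> \<L>. take N W' = W"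
    using sparse_family_exists[OF X] by blast
  then show ?case by (intro exI[of _ n] exI[of _ \<L>]) (auto intro: bchoice simp: Bex_def)
next
  case (insert x S)
  then obtain n \<L> where fam: "sparse_family X N n \<L>"
    and IH: "\<And>\<chi>. \<chi> \<in> words X n \<rightarrow> {..<k} \<Longrightarrow> \<exists>\<phi> c.
    (\<forall>W \<in> lines X N. \<phi> W \<in> \<L> \<and> take N (\<phi> W) = W \<and>
      (\<forall>a \<in> X. plug W a \<in> S \<longrightarrow> \<chi> (plug (\<phi> W) a) = c (plug W a)))" by auto
  have "x \<in> words X N" using insert by blast
  from sparse_family_step[OF X(1) fam this, of k]
  obtain n' \<L>' where fam': "sparse_family X N n' \<L>'"
    and step: "\<And>\<chi>. \<chi> \<in> words X n' \<rightarrow> {..<k} \<Longrightarrow> \<exists>e \<psi> c.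
    (\<forall>W \<in> \<L>. e W \<in> \<L>' \<and> take N (e W) = take N W \<and>
      (\<forall>a \<in> X. plug (e W) a = \<psi> (plug W a))) \<and>
    (\<forall>W \<in> \<L>. \<forall>a \<in> X. take N (plug W a) = x \<longrightarrow> \<chi> (\<psi> (plug W a)) = c)" by blast
  show ?case
  proof (intro exI[of _ n'] exI[of _ \<L>'] conjI fam' ballI)
    fix \<chi> assume \<chi>: "\<chi> \<in> words X n' \<rightarrow> {..<k}"
    from step[OF \<chi>] obtain e \<psi> d where
      e: "\<And>W. W \<in> \<L> \<Longrightarrow> e W \<in> \<L>'" "\<And>W. W \<in> \<L> \<Longrightarrow> take N (e W) = take N W"
        "\<And>W a. W \<in> \<L> \<Longrightarrow> a \<in> X \<Longrightarrow> plug (e W) a = \<psi> (plug W a)"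
      and d: "\<And>W a. W \<in> \<L> \<Longrightarrow> a \<in> X \<Longrightarrow> take N (plug W a) = x \<Longrightarrow> \<chi> (\<psi> (plug W a)) = d"
      by blast
    \<comment> \<open>\<open>\<psi>\<close> is known to give words of length \<open>n'\<close> only
      on points of lines of \<open>\<L>\<close>. Elsewhere the colour of a constant word is a
      default below \<open>k\<close>.\<close>
    let ?\<chi> = "\<lambda>q. if \<exists>W \<in> \<L>. \<exists>a \<in> X. q = plug W a then \<chi> (\<psi> q) else \<chi> (replicate n' a0)"
    have "\<chi> (\<psi> (plug W a)) < k" if "W \<in> \<L>" "a \<in> X" for W a
      using Pi_mem[OF \<chi> plug_in_words] e(1,3) that fam'
      by (metis lessThan_iff sparse_family_def subsetD)
    moreover have "\<chi> (replicate n' a0) < k"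
      using Pi_mem[OF \<chi>, of "replicate n' a0"] X by (auto simp: words_def set_replicate_conv_if)
    ultimately have "?\<chi> \<in> words X n \<rightarrow> {..<k}" by auto
    from IH[OF this] obtain \<phi> c where
      \<phi>: "\<And>W. W \<in> lines X N \<Longrightarrow> \<phi> W \<in> \<L>" "\<And>W. W \<in> lines X N \<Longrightarrow> take N (\<phi> W) = W"
      and c: "\<And>W a. W \<in> lines X N \<Longrightarrow> a \<in> X \<Longrightarrow> plug W a \<in> S \<Longrightarrow> ?\<chi> (plug (\<phi> W) a) = c (plug W a)"
      by blast
    have "\<chi> (plug (e (\<phi> W)) a) = (c(x := d)) (plug W a)"
      if W: "W \<in> lines X N" and a: "a \<in> X" and "plug W a \<in> insert x S" for W a
    proof (cases "plug W a = x")
      case True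
      then show ?thesis using \<phi>[OF W] d[OF \<phi>(1)[OF W] a] e(3)[OF _ a] by (simp add: take_plug)
    next
      case False
      have "\<exists>W' \<in> \<L>. \<exists>a' \<in> X. plug (\<phi> W) a = plug W' a'" using \<phi>(1)[OF W] a by blast
      with False that c[OF W a] e(3)[OF \<phi>(1)[OF W] a] show ?thesis by simp
    qed
    then show "\<exists>\<phi> c. \<forall>W \<in> lines X N. \<phi> W \<in> \<L>' \<and> take N (\<phi> W) = W \<and>
      (\<forall>a \<in> X. plug W a \<in> insert x S \<longrightarrow> \<chi> (plug (\<phi> W) a) = c (plug W a))"
      using \<phi> e by (intro exI[of _ "e \<circ> \<phi>"] exI[of _ "c(x := d)"]) auto
  qed
qed

text \<open>With all words of length \<open>N\<close> as \<open>S\<close>, the colour on lifted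
  lines comes from a colouring of \<open>words X N\<close>. Ordinary Hales--Jewett there gives a
  line whose lift is monochromatic, and lifts lie in a family with distinct active sets.\<close>

theorem sparse_hales_jewett:
  fixes k :: nat
  assumes X: "finite X" "X \<noteq> {}"
  shows "\<exists>n \<L>. \<L> \<subseteq> lines X n \<and> inj_on active \<L> \<and>
    (\<forall>\<chi> \<in> words X n \<rightarrow> {..<k}. \<exists>W \<in> \<L>. \<exists>c. \<forall>a \<in> X. \<chi> (plug W a) = c)"
proof -
  obtain a0 where a0: "a0 \<in> X" using X by blast
  obtain N where N: "hj_number X k N" using hales_jewett[OF X(1)] by blast
  from sparse_family_iterate[OF X(1) a0 finite_words[OF X(1)] order_refl, of N k]
  obtain n \<L> where fam: "sparse_family X N n \<L>"
    and it: "\<And>\<chi>. \<chi> \<in> words X n \<rightarrow> {..<k} \<Longrightarrow> \<exists>\<phi> c.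
    (\<forall>W \<in> lines X N. \<phi> W \<in> \<L> \<and> take N (\<phi> W) = W \<and>
      (\<forall>a \<in> X. plug W a \<in> words X N \<longrightarrow> \<chi> (plug (\<phi> W) a) = c (plug W a)))" by blast
  have "\<exists>W \<in> \<L>. \<exists>c. \<forall>a \<in> X. \<chi> (plug W a) = c" if \<chi>: "\<chi> \<in> words X n \<rightarrow> {..<k}" for \<chi>
  proof -
    from it[OF \<chi>] obtain \<phi> c where \<phi>: "\<And>W. W \<in> lines X N \<Longrightarrow> \<phi> W \<in> \<L>"
      and c: "\<And>W a. W \<in> lines X N \<Longrightarrow> a \<in> X \<Longrightarrow> \<chi> (plug (\<phi> W) a) = c (plug W a)"
      using plug_in_words by metis
    have "replicate n a0 \<in> words X n" using a0 by (auto simp: words_def)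
    with \<chi> have "k > 0" by fastforce
    \<comment> \<open>\<open>c\<close> is controlled only at points of lines. Truncating at
      \<open>k - 1\<close> makes it a genuine \<open>k\<close>-colouring and changes no colour that
      occurs on a lifted line.\<close>
    moreover define \<xi> where "\<xi> = (\<lambda>w. min (c w) (k - 1))"
    ultimately have "\<xi> w < k" for w by auto
    from hj_numberE[OF N, of \<xi>, OF this] obtain W d where W: "W \<in> lines X N"
      and d: "\<And>a. a \<in> X \<Longrightarrow> \<xi> (plug W a) = d" by blast
    have "\<chi> (plug (\<phi> W) a) = d" if "a \<in> X" for a
    proof -
      have "plug (\<phi> W) a \<in> words X n"
        using fam \<phi>[OF W] plug_in_words[OF _ that] by (auto simp: sparse_family_def)
      then have "c (plug W a) < k" using Pi_mem[OF \<chi>] c[OF W that] by fastforce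
      then show ?thesis using d[OF that] c[OF W that] by (simp add: \<xi>_def)
    qed
    then show ?thesis using \<phi>[OF W] by blast
  qed
  then show ?thesis using fam unfolding sparse_family_def by blast
qed

subsection \<open>The partite lemma for closed embeddings\<close>

definition U_closed :: "'r set \<Rightarrow> ('v, 'r) rel_structure \<Rightarrow> 'v set \<Rightarrow> bool" where
  "U_closed U B X \<longleftrightarrow> (\<forall>R \<in> U. \<forall>xs y. xs @ [y] \<in> rel B R \<longrightarrow> set xs \<subseteq> X \<longrightarrow> y \<in> X)"

lemma U_closedD: "U_closed U B X \<Longrightarrow> R \<in> U \<Longrightarrow> xs @ [y] \<in> rel B R \<Longrightarrow> set xs \<subseteq> X \<Longrightarrow> y \<in> X"
  unfolding U_closed_def by blast

lemma obtain_map_preimage: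
  assumes "set ys \<subseteq> f ` X" obtains xs where "set xs \<subseteq> X" "ys = map f xs"
proof -
  have "ys \<in> map f ` lists X" using assms by (auto simp flip: lists_image)
  then show ?thesis using that by auto
qed

lemma EmbI:
  assumes "f \<in> verts A \<rightarrow>\<^sub>E verts B" "inj_on f (verts A)"
    "\<And>R xs. R \<in> symbols L \<Longrightarrow> set xs \<subseteq> verts A \<Longrightarrow> length xs = arity L R \<Longrightarrow>
      xs \<in> rel A R \<longleftrightarrow> map f xs \<in> rel B R"
  shows "f \<in> Emb L A B"
  using assms by (auto simp: Emb_def tuples_def)

lemma EmbD:
  assumes "f \<in> Emb L A B"
  shows "f \<in> verts A \<rightarrow>\<^sub>E verts B" "inj_on f (verts A)" "\<And>x. x \<in> verts A \<Longrightarrow> f x \<in> verts B"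
    "\<And>R xs. R \<in> symbols L \<Longrightarrow> set xs \<subseteq> verts A \<Longrightarrow> length xs = arity L R \<Longrightarrow>
      xs \<in> rel A R \<longleftrightarrow> map f xs \<in> rel B R"
  using assms by (auto simp: Emb_def tuples_def)

lemma L_structureD:
  assumes "L_structure L M" "R \<in> symbols L" "xs \<in> rel M R"
  shows "set xs \<subseteq> verts M" "length xs = arity L R"
  using assms by (auto simp: L_structure_def tuples_def)

lemma substructure_image:
  assumes "L_structure L A" "f \<in> Emb L A B"
  shows "substructure L (image_structure f A) B"
  unfolding substructure_def
proof (intro conjI ballI)
  show "verts (image_structure f A) \<subseteq> verts B"
    using EmbD(3)[OF assms(2)] by (auto simp: image_structure_def)
  fix R assume R: "R \<in> symbols L"
  show "rel (image_structure f A) R = rel B R \<inter> tuples (verts (image_structure f A)) (arity L R)"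
  proof (intro equalityI subsetI)
    fix ys assume "ys \<in> rel (image_structure f A) R"
    then obtain xs where xs: "xs \<in> rel A R" "ys = map f xs" by (auto simp: image_structure_def)
    note L_structureD[OF assms(1) R xs(1)]
    then show "ys \<in> rel B R \<inter> tuples (verts (image_structure f A)) (arity L R)"
      using EmbD(4)[OF assms(2) R] xs by (auto simp: image_structure_def tuples_def)
  next
    fix ys assume ys: "ys \<in> rel B R \<inter> tuples (verts (image_structure f A)) (arity L R)"
    then have "set ys \<subseteq> f ` verts A" by (auto simp: image_structure_def tuples_def)
    then obtain xs where "set xs \<subseteq> verts A" "ys = map f xs" by (rule obtain_map_preimage)
    then show "ys \<in> rel (image_structure f A) R"
      using ys EmbD(4)[OF assms(2) R] by (auto simp: image_structure_def tuples_def)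
  qed
qed

text \<open>The image of an embedding is always an induced substructure, so only the closure of its
  vertex set remains to be checked.\<close>

lemma Emb_U_iff:
  assumes "L_structure L A"
  shows "f \<in> Emb_U L U A B \<longleftrightarrow> f \<in> Emb L A B \<and> U_closed U B (f ` verts A)"
  using substructure_image[OF assms]
  by (auto simp: Emb_U_def U_closed_substructure_def U_closed_def image_structure_def)

lemma map_restrict: "set xs \<subseteq> X \<Longrightarrow> map (restrict f X) xs = map f xs"
  by auto

lemma map_compose_on: "set xs \<subseteq> X \<Longrightarrow> map (compose X g f) xs = map g (map f xs)"
  by (auto simp: compose_def)

text \<open>Closure passes through two stages: \<open>g\<close> puts the last entry into the image
  of \<open>B\<close>, and after pulling the tuple back to \<open>B\<close>, closure of
  \<open>f\<close> applies.\<close>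

lemma compose_Emb_U:
  assumes U: "U \<subseteq> symbols L" and str: "L_structure L A" "L_structure L B" "L_structure L C"
    and f: "f \<in> Emb_U L U A B" and g: "g \<in> Emb_U L U B C"
  shows "compose (verts A) g f \<in> Emb_U L U A C"
proof -
  have f': "f \<in> Emb L A B" "U_closed U B (f ` verts A)"
    and g': "g \<in> Emb L B C" "U_closed U C (g ` verts B)"
    using f g Emb_U_iff str by blast+
  have fA: "f ` verts A \<subseteq> verts B" using EmbD(3)[OF f'(1)] by blast
  have im: "compose (verts A) g f ` verts A = g ` f ` verts A" by (auto simp: compose_def)
  have "compose (verts A) g f \<in> Emb L A C"
  proof (rule EmbI)
    show "compose (verts A) g f \<in> verts A \<rightarrow>\<^sub>E verts C"
      using EmbD(3)[OF f'(1)] EmbD(3)[OF g'(1)] by (auto simp: compose_def)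
    show "inj_on (compose (verts A) g f) (verts A)"
      using EmbD(2)[OF f'(1)] inj_on_subset[OF EmbD(2)[OF g'(1)] fA]
      by (auto simp: compose_def inj_on_def)
    show "xs \<in> rel A R \<longleftrightarrow> map (compose (verts A) g f) xs \<in> rel C R"
      if "R \<in> symbols L" "set xs \<subseteq> verts A" "length xs = arity L R" for R xs
    proof -
      have "set (map f xs) \<subseteq> verts B" using that fA by auto
      then show ?thesis
        using EmbD(4)[OF f'(1) that] EmbD(4)[OF g'(1) that(1), of "map f xs"] that
        by (simp add: map_compose_on del: map_map)
    qed
  qed
  moreover have "U_closed U C (g ` f ` verts A)"
    unfolding U_closed_def
  proof (intro ballI allI impI)
    fix R xs y assume R: "R \<in> U" and r: "xs @ [y] \<in> rel C R" and xs: "set xs \<subseteq> g ` f ` verts A"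
    have "y \<in> g ` verts B"
      using U_closedD[OF g'(2) R r] xs fA by blast
    then obtain b where b: "b \<in> verts B" "y = g b" by blast
    obtain us where us: "set us \<subseteq> f ` verts A" "xs = map g us" using xs by (rule obtain_map_preimage)
    have "length (xs @ [y]) = arity L R" using L_structureD[OF str(3) _ r] R U by blast
    then have "us @ [b] \<in> rel B R"
      using EmbD(4)[OF g'(1), of R "us @ [b]"] us b r R U fA by auto
    then have "b \<in> f ` verts A" using U_closedD[OF f'(2) R] us by blast
    then show "y \<in> g ` f ` verts A" using b by blast
  qed
  ultimately show ?thesis using Emb_U_iff[OF str(1)] im by metis
qed

text \<open>Every amalgam has a new vertex type. Renumbering keeps the iteration within
  \<open>nat\<close>.\<close>

lemma relabel_nat:
  fixes M :: "('v, 'r) rel_structure"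
  assumes M: "L_structure L M" "finite (verts M)"
  obtains N :: "(nat, 'r) rel_structure" and f where "L_structure L N" "finite (verts N)"
    "f \<in> Emb_U L U M N" "inj_on f (verts M)"
proof -
  obtain i :: "'v \<Rightarrow> nat" where i: "inj_on i (verts M)"
    using finite_imp_inj_to_nat_seg[OF M(2)] by metis
  define f where "f = restrict i (verts M)"
  have f: "inj_on f (verts M)" using i by (simp add: f_def inj_on_def)
  \<comment> \<open>Symbols outside \<open>L\<close> may have tuples that leave the vertex set.
    These are cut off so that the whole vertex set is closed.\<close>
  define N where "N = \<lparr>verts = f ` verts M,
    rel = (\<lambda>R. map f ` (rel M R \<inter> {xs. set xs \<subseteq> verts M}))\<rparr>"
  have "L_structure L N" using M(1)
    by (fastforce simp: L_structure_def N_def tuples_def)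
  moreover have "f \<in> Emb L M N"
  proof (rule EmbI)
    fix R xs assume "set xs \<subseteq> verts M"
    then show "xs \<in> rel M R \<longleftrightarrow> map f xs \<in> rel N R"
      using inj_on_map_eq_map[of f] inj_on_subset[OF f]
      by (auto simp: N_def)
  qed (use f in \<open>auto simp: N_def f_def\<close>)
  moreover have "U_closed U N (f ` verts M)"
    unfolding U_closed_def
  proof (intro ballI allI impI)
    fix R xs y assume "xs @ [y] \<in> rel N R"
    then obtain zs where "set zs \<subseteq> verts M" "xs @ [y] = map f zs" by (auto simp: N_def)
    then have "set (xs @ [y]) \<subseteq> f ` verts M" by (simp only: set_map image_mono)
    then show "y \<in> f ` verts M" by simp
  qed
  ultimately show ?thesis using that[of N f] Emb_U_iff[OF M(1)] M(2) f by (auto simp: N_def)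
qed

section \<open>The amalgam of copies of \<open>P\<close> along a sparse family of lines\<close>

definition copies_over :: "'r rel_language \<Rightarrow> 'r set \<Rightarrow> ('a, 'r) rel_structure \<Rightarrow>
    ('v, 'r) rel_structure \<Rightarrow> ('v \<Rightarrow> 'i) \<Rightarrow> ('a \<Rightarrow> 'i) \<Rightarrow> ('a \<Rightarrow> 'v) set" where
  "copies_over L U A P p \<alpha> = {g \<in> Emb_U L U A P. \<forall>x \<in> verts A. p (g x) = \<alpha> x}"

locale line_amalgam =
  fixes L :: "'r rel_language" and U :: "'r set" and A :: "('a, 'r) rel_structure"
    and P :: "('v, 'r) rel_structure" and p :: "'v \<Rightarrow> 'i" and \<alpha> :: "'a \<Rightarrow> 'i"
    and n :: nat and \<L> :: "('a \<Rightarrow> 'v) option list set"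
  assumes U: "U \<subseteq> symbols L" and str_A: "L_structure L A" and fin_A: "finite (verts A)"
    and str_P: "L_structure L P" and fin_P: "finite (verts P)" and inj_\<alpha>: "inj_on \<alpha> (verts A)"
    and lines: "\<L> \<subseteq> lines (copies_over L U A P p \<alpha>) n" and sparse: "inj_on active \<L>"
begin

definition \<Sigma> :: "('a \<Rightarrow> 'v) set" where "\<Sigma> = copies_over L U A P p \<alpha>"

definition D :: "'v set" where "D = (\<Union>g \<in> \<Sigma>. g ` verts A)"

text \<open>The place of \<open>v\<close> in a copy of \<open>A\<close>. As \<open>\<alpha>\<close>
  is injective, it is the same in all copies over \<open>\<alpha>\<close> containing
  \<open>v\<close>.\<close>

definition idx :: "'v \<Rightarrow> 'a" where "idx v = inv_into (verts A) \<alpha> (p v)"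

text \<open>A fixed coordinate holds the vertex of the fixed copy \<open>g\<close> at the place of
  \<open>v\<close>; an active one holds \<open>v\<close>.\<close>

definition coords :: "('a \<Rightarrow> 'v) option list \<Rightarrow> 'v \<Rightarrow> 'v list" where
  "coords W v = map (\<lambda>s. case s of None \<Rightarrow> v | Some g \<Rightarrow> g (idx v)) W"

text \<open>Only vertices in copies over \<open>\<alpha>\<close> are glued. The others are tagged
  with the line and stay private to their copy of \<open>P\<close>.\<close>

definition emb :: "('a \<Rightarrow> 'v) option list \<Rightarrow> 'v \<Rightarrow> 'v list + 'v \<times> ('a \<Rightarrow> 'v) option list" where
  "emb W v = (if v \<in> D then Inl (coords W v) else Inr (v, W))"

definition Q :: "('v list + 'v \<times> ('a \<Rightarrow> 'v) option list, 'r) rel_structure" where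
  "Q = \<lparr>verts = (\<Union>W \<in> \<L>. emb W ` verts P), rel = (\<lambda>R. \<Union>W \<in> \<L>. map (emb W) ` rel P R)\<rparr>"

text \<open>All coordinates of a glued vertex have the same projection, so the head can represent
  them.\<close>

definition proj :: "'v list + 'v \<times> ('a \<Rightarrow> 'v) option list \<Rightarrow> 'i" where
  "proj q = (case q of Inl xs \<Rightarrow> p (hd xs) | Inr (v, W) \<Rightarrow> p v)"

lemma \<Sigma>D:
  assumes "g \<in> \<Sigma>"
  shows "g \<in> Emb_U L U A P" "g \<in> Emb L A P" "U_closed U P (g ` verts A)"
    "\<And>x. x \<in> verts A \<Longrightarrow> p (g x) = \<alpha> x" "\<And>x. x \<in> verts A \<Longrightarrow> g x \<in> verts P"
proof -
  show g: "g \<in> Emb_U L U A P" "\<And>x. x \<in> verts A \<Longrightarrow> p (g x) = \<alpha> x"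
    using assms by (auto simp: \<Sigma>_def copies_over_def)
  show g': "g \<in> Emb L A P" "U_closed U P (g ` verts A)" using g(1) Emb_U_iff[OF str_A] by blast+
  show "\<And>x. x \<in> verts A \<Longrightarrow> g x \<in> verts P" by (rule EmbD(3)[OF g'(1)])
qed

lemma finite_\<Sigma>: "finite \<Sigma>"
proof (rule finite_subset)
  show "\<Sigma> \<subseteq> verts A \<rightarrow>\<^sub>E verts P" using \<Sigma>D(2) EmbD(1) by blast
qed (simp add: finite_PiE fin_A fin_P)

lemma lineD:
  assumes "W \<in> \<L>"
  shows "length W = n" "None \<in> set W" "\<And>j g. j < n \<Longrightarrow> W ! j = Some g \<Longrightarrow> g \<in> \<Sigma>" "n > 0"
proof -
  have W: "W \<in> lines \<Sigma> n" using assms lines by (auto simp: \<Sigma>_def)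
  then show n: "length W = n" and None: "None \<in> set W" by (auto simp: lines_def)
  show "n > 0" using n None by auto
  show "g \<in> \<Sigma>" if "j < n" "W ! j = Some g" for j g
  proof -
    have "Some g \<in> set W" using that n by (metis nth_mem)
    then show ?thesis using W by (auto simp: lines_def)
  qed
qed

lemma idx_copy: "g \<in> \<Sigma> \<Longrightarrow> x \<in> verts A \<Longrightarrow> idx (g x) = x"
  by (simp add: idx_def \<Sigma>D(4) inj_\<alpha>)

lemma D_idx: "v \<in> D \<Longrightarrow> idx v \<in> verts A \<and> v \<in> verts P \<and> p v = \<alpha> (idx v)"
  by (auto simp: D_def idx_copy \<Sigma>D)

lemma copy_in_D: "g \<in> \<Sigma> \<Longrightarrow> x \<in> verts A \<Longrightarrow> g x \<in> D"
  by (auto simp: D_def)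

lemma length_coords: "W \<in> \<L> \<Longrightarrow> length (coords W v) = n"
  by (simp add: coords_def lineD)

lemma coords_nth:
  "W \<in> \<L> \<Longrightarrow> j < n \<Longrightarrow> coords W v ! j = (case W ! j of None \<Rightarrow> v | Some g \<Rightarrow> g (idx v))"
  by (simp add: coords_def lineD)

lemma coords_nth_idx:
  assumes "W \<in> \<L>" "j < n" "v \<in> D"
  shows "coords W v ! j \<in> D" "idx (coords W v ! j) = idx v"
  using assms lineD(3)[OF assms(1,2)] D_idx[OF assms(3)]
  by (auto simp: coords_nth copy_in_D idx_copy split: option.splits)

lemma coords_eq_idx:
  assumes "W \<in> \<L>" "W' \<in> \<L>" "v \<in> D" "v' \<in> D" "coords W v = coords W' v'"
  shows "idx v = idx v'"
  using coords_nth_idx(2)[OF assms(1) lineD(4)[OF assms(1)] assms(3)]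
    coords_nth_idx(2)[OF assms(2) lineD(4)[OF assms(1)] assms(4)] assms(5) by simp

lemma proj_emb:
  assumes "W \<in> \<L>" shows "proj (emb W v) = p v"
proof (cases "v \<in> D")
  case True
  have "hd (coords W v) = coords W v ! 0"
    using length_coords[OF assms] lineD(4)[OF assms] by (metis hd_conv_nth list.size(3) less_irrefl)
  then show ?thesis
    using coords_nth_idx[OF assms lineD(4)[OF assms] True] D_idx True
    by (metis (no_types, lifting) emb_def proj_def sum.case(1))
qed (simp add: emb_def proj_def)

text \<open>An active coordinate of \<open>W\<close> stores the vertex itself.\<close>

lemma inj_emb:
  assumes "W \<in> \<L>" shows "inj (emb W)"
proof (rule injI)
  fix v v' assume eq: "emb W v = emb W v'"
  obtain j where j: "j < n" "W ! j = None" using lineD(1,2)[OF assms] by (metis in_set_conv_nth)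
  have "v = v'" if "coords W v = coords W v'"
    using that coords_nth[OF assms j(1)] j(2) by (metis option.case(1))
  then show "v = v'" using eq by (auto simp: emb_def split: if_splits)
qed

text \<open>A coordinate active in \<open>W\<close> and fixed in \<open>W'\<close> exhibits
  \<open>x\<close> as \<open>map g u\<close>. Without one, a common active coordinate gives
  \<open>x = x'\<close>; the active sets differ, so some coordinate is fixed in \<open>W\<close> and
  active in \<open>W'\<close>, and it exhibits \<open>x'\<close> as \<open>map g u\<close>.\<close>

lemma moving_coordinate:
  assumes W: "W \<in> \<L>" "W' \<in> \<L>" "W \<noteq> W'"
    and eq: "\<And>j. j < n \<Longrightarrow> (case W ! j of None \<Rightarrow> x | Some g \<Rightarrow> map g u) =
      (case W' ! j of None \<Rightarrow> x' | Some g \<Rightarrow> map g u)"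
  shows "\<exists>h \<in> \<Sigma>. x = map h u"
proof (cases "\<exists>j < n. W ! j = None \<and> W' ! j \<noteq> None")
  case True
  then obtain j g where "j < n" "W ! j = None" "W' ! j = Some g" by auto
  then show ?thesis using eq[of j] lineD(3)[OF W(2)] by auto
next
  case False
  obtain i where i: "i < n" "W ! i = None" using lineD(1,2)[OF W(1)] by (metis in_set_conv_nth)
  then have "x = x'" using False eq[of i] by auto
  have "active W \<noteq> active W'" using sparse W by (auto dest: inj_onD)
  then obtain j where "j < n" "(W ! j = None) \<noteq> (W' ! j = None)"
    using lineD(1) W by (auto simp: active_def list_eq_iff_nth_eq)
  with False obtain g where "j < n" "W ! j = Some g" "W' ! j = None" by auto
  then show ?thesis using eq[of j] lineD(3)[OF W(1)] \<open>x = x'\<close> by auto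
qed

text \<open>For a tuple of a relation in \<open>U\<close>, closure of the copies makes the last
  entry determined by the others. Gluing along \<open>u\<close> then extends to
  \<open>b\<close>.\<close>

definition determined :: "'a list \<Rightarrow> 'a \<Rightarrow> bool" where
  "determined u b \<longleftrightarrow> b \<in> verts A \<and> (\<forall>g \<in> \<Sigma>. \<forall>g' \<in> \<Sigma>. map g u = map g' u \<longrightarrow> g b = g' b)"

text \<open>Lines with different active sets meet only inside closed copies of \<open>A\<close>. This is what makes
  the copies of \<open>P\<close> closed in the amalgam.\<close>

lemma overlap:
  assumes W: "W \<in> \<L>" "W' \<in> \<L>" "W \<noteq> W'" and eq: "map (emb W) x = map (emb W') x'"
  shows "\<exists>u. \<exists>h \<in> \<Sigma>. \<exists>h' \<in> \<Sigma>. set u \<subseteq> verts A \<and> x = map h u \<and> x' = map h' u \<and>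
    (\<forall>b. determined u b \<longrightarrow> emb W (h b) = emb W' (h' b))"
proof -
  have len: "length x = length x'" using eq by (metis length_map)
  have pt: "x ! i \<in> D \<and> x' ! i \<in> D \<and> coords W (x ! i) = coords W' (x' ! i)" if "i < length x" for i
  proof -
    have "emb W (x ! i) = emb W' (x' ! i)" using eq that len by (metis nth_map)
    then show ?thesis using W(3) by (auto simp: emb_def split: if_splits)
  qed
  define u where "u = map idx x"
  have u': "u = map idx x'"
    using pt coords_eq_idx[OF W(1,2)] len by (auto simp: u_def list_eq_iff_nth_eq)
  have uA: "set u \<subseteq> verts A" using pt D_idx by (auto simp: u_def in_set_conv_nth)
  \<comment> \<open>The glued tuples are compared at one coordinate: an active line shows its own
    tuple, a fixed letter \<open>g\<close> shows \<open>map g u\<close>.\<close>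
  have col: "(case W ! j of None \<Rightarrow> x | Some g \<Rightarrow> map g u) =
      (case W' ! j of None \<Rightarrow> x' | Some g \<Rightarrow> map g u)" if "j < n" for j
  proof -
    have "(case W ! j of None \<Rightarrow> x | Some g \<Rightarrow> map g u) = map (\<lambda>v. coords W v ! j) x"
      using coords_nth[OF W(1) that] by (auto simp: u_def split: option.splits)
    also have "\<dots> = map (\<lambda>v. coords W' v ! j) x'"
      using pt len by (intro nth_equalityI) auto
    also have "\<dots> = (case W' ! j of None \<Rightarrow> x' | Some g \<Rightarrow> map g u)"
      using coords_nth[OF W(2) that] by (auto simp: u' split: option.splits)
    finally show ?thesis .
  qed
  obtain h where h: "h \<in> \<Sigma>" "x = map h u" using moving_coordinate[OF W col] by blast
  obtain h' where h': "h' \<in> \<Sigma>" "x' = map h' u"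
    using moving_coordinate[OF W(2,1) W(3)[symmetric] col[symmetric]] by blast
  have "emb W (h b) = emb W' (h' b)"
    if "determined u b" for b
  proof -
    have b: "b \<in> verts A"
      and det: "\<And>g g'. g \<in> \<Sigma> \<Longrightarrow> g' \<in> \<Sigma> \<Longrightarrow> map g u = map g' u \<Longrightarrow> g b = g' b"
      using that by (auto simp: determined_def)
    \<comment> \<open>Coordinate \<open>j\<close> holds the value at \<open>b\<close> of a copy of
      \<open>A\<close>: the fixed letter, or \<open>h\<close> resp. \<open>h'\<close> if active. By
      \<open>col\<close> the two copies agree on \<open>u\<close>, hence on
      \<open>b\<close>.\<close>
    have "coords W (h b) = coords W' (h' b)"
    proof (rule nth_equalityI)
      show "length (coords W (h b)) = length (coords W' (h' b))" using W by (simp add: length_coords)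
      fix j assume "j < length (coords W (h b))"
      then have j: "j < n" using W by (simp add: length_coords)
      show "coords W (h b) ! j = coords W' (h' b) ! j"
        using col[OF j] det lineD(3)[OF W(1) j] lineD(3)[OF W(2) j] h h' b
        by (auto simp: coords_nth[OF W(1) j] coords_nth[OF W(2) j] idx_copy split: option.splits)
    qed
    then show ?thesis using copy_in_D b h(1) h'(1) by (simp add: emb_def)
  qed
  then show ?thesis using uA h h' by blast
qed

lemma str_Q: "L_structure L Q"
  using L_structureD[OF str_P] unfolding L_structure_def Q_def tuples_def by fastforce

lemma finite_Q: "finite (verts Q)"
proof -
  have "finite \<L>" using finite_subset[OF lines] finite_lines[OF finite_\<Sigma>] by (simp add: \<Sigma>_def)
  then show ?thesis by (simp add: Q_def fin_P)
qed

text \<open>A tuple visible in two copies of \<open>P\<close> lies, by \<open>overlap\<close>, in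
  two copies of \<open>A\<close> at the same places \<open>u\<close>. Relations and closure are
  transferred through \<open>A\<close>.\<close>

lemma emb_Emb_U:
  assumes W: "W \<in> \<L>" shows "restrict (emb W) (verts P) \<in> Emb_U L U P Q"
proof -
  let ?e = "restrict (emb W) (verts P)"
  have "?e \<in> Emb L P Q"
  proof (rule EmbI)
    show "?e \<in> verts P \<rightarrow>\<^sub>E verts Q" using W by (auto simp: Q_def)
    show "inj_on ?e (verts P)" using inj_emb[OF W] by (simp add: inj_on_def)
    fix R xs assume R: "R \<in> symbols L" and xs: "set xs \<subseteq> verts P" "length xs = arity L R"
    have "xs \<in> rel P R" if W': "W' \<in> \<L>" and xs': "xs' \<in> rel P R" and eq: "map (emb W) xs = map (emb W') xs'" for W' xs'
    proof (cases "W' = W")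
      case True
      then have "xs = xs'" using eq inj_map_eq_map[OF inj_emb[OF W]] by simp
      then show ?thesis using xs' by simp
    next
      case False
      obtain u h h' where u: "set u \<subseteq> verts A" "h \<in> \<Sigma>" "h' \<in> \<Sigma>" "xs = map h u" "xs' = map h' u"
        using overlap[OF W W' False[symmetric] eq] by blast
      have "length u = arity L R" using xs u by simp
      then show ?thesis
        using EmbD(4)[OF \<Sigma>D(2)[OF u(2)] R u(1)] EmbD(4)[OF \<Sigma>D(2)[OF u(3)] R u(1)] xs' u by simp
    qed
    then show "xs \<in> rel P R \<longleftrightarrow> map ?e xs \<in> rel Q R"
      unfolding map_restrict[OF xs(1)] using W by (auto simp: Q_def)
  qed
  moreover have "U_closed U Q (emb W ` verts P)"
    unfolding U_closed_def
  proof (intro ballI allI impI)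
    fix R ys y assume R: "R \<in> U" and r: "ys @ [y] \<in> rel Q R" and ys: "set ys \<subseteq> emb W ` verts P"
    have RL: "R \<in> symbols L" using R U by blast
    obtain x where x: "set x \<subseteq> verts P" "ys = map (emb W) x" using ys by (rule obtain_map_preimage)
    from r obtain W' t where W': "W' \<in> \<L>" and t: "t \<in> rel P R" "ys @ [y] = map (emb W') t"
      by (auto simp: Q_def)
    from t(2) obtain x' b' where t': "t = x' @ [b']" "ys = map (emb W') x'" "y = emb W' b'"
      by (auto simp: map_eq_append_conv append_eq_map_conv)
    have b'P: "b' \<in> verts P" using L_structureD[OF str_P RL t(1)] t' by auto
    show "y \<in> emb W ` verts P"
    proof (cases "W' = W")
      case True
      then show ?thesis using b'P t' by blast
    next
      case False
      obtain u h h' where u: "set u \<subseteq> verts A" "h \<in> \<Sigma>" "h' \<in> \<Sigma>" "x = map h u" "x' = map h' u"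
        and det: "\<And>b. determined u b \<Longrightarrow> emb W (h b) = emb W' (h' b)"
        using overlap[OF W W' False[symmetric] trans[OF x(2)[symmetric] t'(2)]] by blast
      \<comment> \<open>The copy \<open>h'\<close> is closed, so \<open>b'\<close> stays inside it,
        and the relation already holds in \<open>A\<close> for \<open>u @ [b]\<close>.\<close>
      have "set x' \<subseteq> h' ` verts A" using u by auto
      then have "b' \<in> h' ` verts A" using U_closedD[OF \<Sigma>D(3)[OF u(3)] R] t(1) t'(1) by blast
      then obtain b where b: "b \<in> verts A" "b' = h' b" by blast
      have ub: "set (u @ [b]) \<subseteq> verts A" "length (u @ [b]) = arity L R"
        using u b L_structureD(2)[OF str_P RL t(1)] t'(1) by auto
      have "map h' (u @ [b]) \<in> rel P R" using t t' u b by simp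
      then have rA: "u @ [b] \<in> rel A R" using EmbD(4)[OF \<Sigma>D(2)[OF u(3)] RL ub] by simp
      \<comment> \<open>Closure of \<open>g'\<close> puts \<open>g b\<close> into the copy
        \<open>g'\<close>, and \<open>idx\<close> shows that it has the place \<open>b\<close>
        there.\<close>
      have "determined u b"
        unfolding determined_def
      proof (intro conjI ballI impI b(1))
        fix g g' assume g: "g \<in> \<Sigma>" "g' \<in> \<Sigma>" "map g u = map g' u"
        have "map g' u @ [g b] \<in> rel P R"
          using EmbD(4)[OF \<Sigma>D(2)[OF g(1)] RL ub] rA g(3) by simp
        moreover have "set (map g' u) \<subseteq> g' ` verts A" using u(1) by auto
        ultimately have "g b \<in> g' ` verts A" using U_closedD[OF \<Sigma>D(3)[OF g(2)] R] by blast
        then obtain c where c: "c \<in> verts A" "g b = g' c" by blast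
        then have "c = b" using idx_copy g b(1) by metis
        then show "g b = g' b" using c by simp
      qed
      from det[OF this] show ?thesis using t'(3) b \<Sigma>D(5)[OF u(2) b(1)] by (metis imageI)
    qed
  qed
  moreover have "?e ` verts P = emb W ` verts P" by simp
  ultimately show ?thesis using Emb_U_iff[OF str_P] by metis
qed

text \<open>The copy \<open>g\<close> carried along \<open>W\<close> is coded vertexwise by the word
  \<open>plug W g\<close>. This turns a colouring of copies into a colouring of words.\<close>

lemma compose_emb_copy:
  assumes "g \<in> \<Sigma>"
  shows "compose (verts A) (restrict (emb W) (verts P)) g =
    (\<lambda>x \<in> verts A. Inl (map (\<lambda>h. h x) (plug W g)))"
proof (rule ext)
  fix x
  show "compose (verts A) (restrict (emb W) (verts P)) g x =
    (\<lambda>x \<in> verts A. Inl (map (\<lambda>h. h x) (plug W g))) x"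
    using \<Sigma>D(5)[OF assms] copy_in_D[OF assms] idx_copy[OF assms]
    by (auto simp: compose_def emb_def coords_def plug_def split: option.splits)
qed

end

text \<open>\<open>P'\<close> is the amalgam for a sparse family over the alphabet of copies with
  two colours; a monochromatic line is the required copy of \<open>P\<close>.\<close>

lemma partite_lemma:
  fixes P :: "('v, 'r) rel_structure" and p :: "'v \<Rightarrow> 'i"
  assumes U: "U \<subseteq> symbols L" and A: "L_structure L A" "finite (verts A)"
    and P: "L_structure L P" "finite (verts P)" and \<alpha>: "inj_on \<alpha> (verts A)"
  shows "\<exists>(P' :: (nat, 'r) rel_structure) p'. L_structure L P' \<and> finite (verts P') \<and>
    (\<forall>\<chi> :: ('a \<Rightarrow> nat) \<Rightarrow> bool. \<exists>e \<in> Emb_U L U P P'. (\<forall>v \<in> verts P. p' (e v) = p v) \<and>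
      (\<exists>c. \<forall>g \<in> copies_over L U A P p \<alpha>. \<chi> (compose (verts A) e g) = c))"
proof (cases "copies_over L U A P p \<alpha> = {}")
  case True
  \<comment> \<open>Without copies over \<open>\<alpha>\<close> there is nothing to colour, and a
    renumbered \<open>P\<close> suffices.\<close>
  obtain P' :: "(nat, 'r) rel_structure" and f where f: "L_structure L P'" "finite (verts P')"
    "f \<in> Emb_U L U P P'" "inj_on f (verts P)" using relabel_nat[OF P] by metis
  then show ?thesis using True
    by (intro exI[of _ P'] exI[of _ "p \<circ> inv_into (verts P) f"]) (auto intro!: bexI[of _ f])
next
  case False
  let ?\<Sigma> = "copies_over L U A P p \<alpha>"
  have "?\<Sigma> \<subseteq> verts A \<rightarrow>\<^sub>E verts P" by (auto simp: copies_over_def Emb_U_def Emb_def)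
  then have "finite ?\<Sigma>" by (rule finite_subset) (simp add: finite_PiE A P)
  from sparse_hales_jewett[OF this False, of 2] obtain n \<L>
    where \<L>: "\<L> \<subseteq> lines ?\<Sigma> n" "inj_on active \<L>"
      and hj: "\<And>\<chi>. \<chi> \<in> words ?\<Sigma> n \<rightarrow> {..<2 :: nat} \<Longrightarrow> \<exists>W \<in> \<L>. \<exists>c. \<forall>a \<in> ?\<Sigma>. \<chi> (plug W a) = c"
    by blast
  interpret line_amalgam L U A P p \<alpha> n \<L>
    using U A P \<alpha> \<L> by unfold_locales
  obtain P' :: "(nat, 'r) rel_structure" and f where P': "L_structure L P'" "finite (verts P')"
    and f: "f \<in> Emb_U L U Q P'" "inj_on f (verts Q)" using relabel_nat[OF str_Q finite_Q] by metis
  define p' where "p' = proj \<circ> inv_into (verts Q) f"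
  have "\<exists>e \<in> Emb_U L U P P'. (\<forall>v \<in> verts P. p' (e v) = p v) \<and>
      (\<exists>c. \<forall>g \<in> ?\<Sigma>. \<chi> (compose (verts A) e g) = c)" for \<chi> :: "('a \<Rightarrow> nat) \<Rightarrow> bool"
  proof -
    \<comment> \<open>\<open>\<chi>\<close> is total on functions, so every word receives a colour,
      whether or not it codes a closed copy of \<open>A\<close>.\<close>
    let ?copy = "\<lambda>w. \<lambda>x \<in> verts A. Inl (map (\<lambda>h. h x) w)"
    let ?\<chi> = "\<lambda>w. of_bool (\<chi> (compose (verts A) f (?copy w))) :: nat"
    have "?\<chi> \<in> words ?\<Sigma> n \<rightarrow> {..<2}" by auto
    from hj[OF this] obtain W c where W: "W \<in> \<L>" and c: "\<forall>g \<in> ?\<Sigma>. ?\<chi> (plug W g) = c" by blast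
    define eW where "eW = restrict (emb W) (verts P)"
    have eW: "eW \<in> Emb_U L U P Q" using emb_Emb_U[OF W] by (simp add: eW_def)
    have eWv: "eW v \<in> verts Q" if "v \<in> verts P" for v
      using EmbD(3)[OF _ that] eW Emb_U_iff[OF P(1)] by blast
    let ?e = "compose (verts P) f eW"
    have "?e \<in> Emb_U L U P P'" by (rule compose_Emb_U[OF U P(1) str_Q P'(1) eW f(1)])
    moreover have "p' (?e v) = p v" if "v \<in> verts P" for v
      using eWv[OF that] that f(2) proj_emb[OF W] by (simp add: p'_def compose_def eW_def)
    moreover have "\<chi> (compose (verts A) ?e g) = (c = 1)" if "g \<in> ?\<Sigma>" for g
    proof -
      have g: "g \<in> \<Sigma>" using that by (simp add: \<Sigma>_def)
      have "compose (verts A) ?e g = compose (verts A) f (compose (verts A) eW g)"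
        using \<Sigma>D(5)[OF g] by (auto simp: compose_def)
      also have "\<dots> = compose (verts A) f (?copy (plug W g))"
        unfolding eW_def compose_emb_copy[OF g] ..
      finally show ?thesis using bspec[OF c that] by (auto split: if_splits simp: of_bool_def)
    qed
    ultimately show ?thesis by blast
  qed
  then show ?thesis using P' by blast
qed

subsection \<open>The partite construction\<close>

text \<open>The colouring is resolved backwards: the last stage fixes the colour over the new
  \<open>\<alpha>\<close>, and the induction hypothesis is applied to the colouring pulled back
  along its embedding \<open>e2\<close>.\<close>

lemma partite_iterate:
  fixes P :: "('v, 'r) rel_structure" and p :: "'v \<Rightarrow> 'i"
  assumes U: "U \<subseteq> symbols L" and A: "L_structure L A" "finite (verts A)"
    and P: "L_structure L P" "finite (verts P)"
    and F: "finite F" "\<And>\<alpha>. \<alpha> \<in> F \<Longrightarrow> inj_on \<alpha> (verts A)"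
  shows "\<exists>(P' :: (nat, 'r) rel_structure) p'. L_structure L P' \<and> finite (verts P') \<and>
    (\<forall>\<chi> :: ('a \<Rightarrow> nat) \<Rightarrow> bool. \<exists>e \<in> Emb_U L U P P'. (\<forall>v \<in> verts P. p' (e v) = p v) \<and>
      (\<forall>\<alpha> \<in> F. \<exists>c. \<forall>g \<in> copies_over L U A P p \<alpha>. \<chi> (compose (verts A) e g) = c))"
  using F
proof (induction F rule: finite_induct)
  case empty
  obtain P' :: "(nat, 'r) rel_structure" and f where f: "L_structure L P'" "finite (verts P')"
    "f \<in> Emb_U L U P P'" "inj_on f (verts P)" using relabel_nat[OF P] by metis
  then show ?case
    by (intro exI[of _ P'] exI[of _ "p \<circ> inv_into (verts P) f"]) (auto intro!: bexI[of _ f])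
next
  case (insert \<alpha> F)
  then obtain P1 :: "(nat, 'r) rel_structure" and p1 where P1: "L_structure L P1" "finite (verts P1)"
    and IH: "\<And>\<chi> :: ('a \<Rightarrow> nat) \<Rightarrow> bool. \<exists>e \<in> Emb_U L U P P1. (\<forall>v \<in> verts P. p1 (e v) = p v) \<and>
      (\<forall>\<alpha> \<in> F. \<exists>c. \<forall>g \<in> copies_over L U A P p \<alpha>. \<chi> (compose (verts A) e g) = c)"
    by auto
  have "inj_on \<alpha> (verts A)" using insert by simp
  from partite_lemma[OF U A P1 this, of p1]
  obtain P2 :: "(nat, 'r) rel_structure" and p2 where P2: "L_structure L P2" "finite (verts P2)"
    and step: "\<And>\<chi> :: ('a \<Rightarrow> nat) \<Rightarrow> bool. \<exists>e \<in> Emb_U L U P1 P2. (\<forall>v \<in> verts P1. p2 (e v) = p1 v) \<and>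
      (\<exists>c. \<forall>g \<in> copies_over L U A P1 p1 \<alpha>. \<chi> (compose (verts A) e g) = c)"
    by auto
  show ?case
  proof (intro exI[of _ P2] exI[of _ p2] conjI P2 allI)
    fix \<chi> :: "('a \<Rightarrow> nat) \<Rightarrow> bool"
    from step[of \<chi>] obtain e2 c2 where e2: "e2 \<in> Emb_U L U P1 P2" "\<And>v. v \<in> verts P1 \<Longrightarrow> p2 (e2 v) = p1 v"
      and c2: "\<And>g. g \<in> copies_over L U A P1 p1 \<alpha> \<Longrightarrow> \<chi> (compose (verts A) e2 g) = c2" by blast
    from IH[of "\<lambda>g. \<chi> (compose (verts A) e2 g)"] obtain e1
      where e1: "e1 \<in> Emb_U L U P P1" "\<And>v. v \<in> verts P \<Longrightarrow> p1 (e1 v) = p v"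
        and c1: "\<And>\<beta>. \<beta> \<in> F \<Longrightarrow> \<exists>c. \<forall>g \<in> copies_over L U A P p \<beta>.
          \<chi> (compose (verts A) e2 (compose (verts A) e1 g)) = c" by auto
    let ?e = "compose (verts P) e2 e1"
    have e1P: "e1 v \<in> verts P1" if "v \<in> verts P" for v
      using e1(1) that by (auto simp: Emb_U_def Emb_def)
    have e: "?e \<in> Emb_U L U P P2" by (rule compose_Emb_U[OF U P(1) P1(1) P2(1) e1(1) e2(1)])
    have pe: "\<forall>v \<in> verts P. p2 (?e v) = p v" using e1P e1(2) e2(2) by (simp add: compose_def)
    have assoc: "compose (verts A) ?e g = compose (verts A) e2 (compose (verts A) e1 g)"
      if "g \<in> copies_over L U A P p \<beta>" for g \<beta>
    proof -
      have "g \<in> verts A \<rightarrow> verts P" using that by (auto simp: copies_over_def Emb_U_def Emb_def)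
      then show ?thesis by (rule compose_assoc[symmetric])
    qed
    have "\<exists>c. \<forall>g \<in> copies_over L U A P p \<beta>. \<chi> (compose (verts A) ?e g) = c" if "\<beta> \<in> insert \<alpha> F" for \<beta>
    proof (cases "\<beta> = \<alpha>")
      case True
      \<comment> \<open>\<open>e1\<close> respects projections, so copies over
        \<open>\<alpha>\<close> stay over \<open>\<alpha>\<close> and inherit the constant colour of
        the last stage.\<close>
      have "compose (verts A) e1 g \<in> copies_over L U A P1 p1 \<alpha>" if "g \<in> copies_over L U A P p \<alpha>" for g
      proof -
        have g: "g \<in> Emb_U L U A P" "\<And>x. x \<in> verts A \<Longrightarrow> p (g x) = \<alpha> x" "\<And>x. x \<in> verts A \<Longrightarrow> g x \<in> verts P"
          using that by (auto simp: copies_over_def Emb_U_def Emb_def)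
        then show ?thesis using compose_Emb_U[OF U A(1) P(1) P1(1) g(1) e1(1)] e1(2)
          by (auto simp: copies_over_def compose_def)
      qed
      then show ?thesis using True assoc c2 by metis
    next
      case False
      then show ?thesis using that c1[of \<beta>] assoc by (metis insertE)
    qed
    then show "\<exists>e \<in> Emb_U L U P P2. (\<forall>v \<in> verts P. p2 (e v) = p v) \<and>
      (\<forall>\<beta> \<in> insert \<alpha> F. \<exists>c. \<forall>g \<in> copies_over L U A P p \<beta>. \<chi> (compose (verts A) e g) = c)"
      using e pe by blast
  qed
qed

section \<open>Disjoint copies of \<open>B\<close>\<close>

definition copies_union :: "'t set \<Rightarrow> ('b, 'r) rel_structure \<Rightarrow> ('t \<times> 'b, 'r) rel_structure" where
  "copies_union T B = \<lparr>verts = T \<times> verts B, rel = (\<lambda>R. \<Union>t \<in> T. map (Pair t) ` rel B R)\<rparr>"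

lemma L_structure_copies_union:
  assumes "L_structure L B" shows "L_structure L (copies_union T B)"
  using assms unfolding L_structure_def tuples_def copies_union_def by fastforce

text \<open>A tuple lies in a single copy. Arity at least 2 leaves an entry before the last one, and
  that entry identifies the copy.\<close>

lemma copies_union_inclusion:
  assumes B: "L_structure L B" and U: "U \<subseteq> symbols L" "\<forall>R \<in> U. arity L R \<ge> 2" and t: "t \<in> T"
  shows "(\<lambda>b \<in> verts B. (t, b)) \<in> Emb_U L U B (copies_union T B)"
proof -
  let ?i = "\<lambda>b \<in> verts B. (t, b)"
  have "?i \<in> Emb L B (copies_union T B)"
  proof (rule EmbI)
    fix R xs assume xs: "set xs \<subseteq> verts B"
    have "map (Pair t) xs = map (Pair s) ys \<Longrightarrow> xs = ys" for s ys
      by (drule arg_cong[of _ _ "map snd"]) (simp add: comp_def)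
    then show "xs \<in> rel B R \<longleftrightarrow> map ?i xs \<in> rel (copies_union T B) R"
      unfolding map_restrict[OF xs] using t by (auto simp: copies_union_def)
  qed (use t in \<open>auto simp: copies_union_def inj_on_def\<close>)
  moreover have "U_closed U (copies_union T B) (?i ` verts B)"
    unfolding U_closed_def
  proof (intro ballI allI impI)
    fix R xs y assume R: "R \<in> U" and r: "xs @ [y] \<in> rel (copies_union T B) R"
      and xs: "set xs \<subseteq> ?i ` verts B"
    from r obtain s zs where zs: "zs \<in> rel B R" "xs @ [y] = map (Pair s) zs"
      by (auto simp: copies_union_def)
    have "length zs \<ge> 2" "set zs \<subseteq> verts B" using L_structureD[OF B _ zs(1)] R U by auto
    then have xs0: "xs \<noteq> []" using zs(2) by (cases zs) (auto split: list.splits)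
    have all: "set (xs @ [y]) \<subseteq> Pair s ` verts B"
      using zs(2) \<open>set zs \<subseteq> verts B\<close> by (simp only: set_map image_mono)
    have "s = t" using xs0 xs all by (cases xs) auto
    then show "y \<in> ?i ` verts B" using all by auto
  qed
  ultimately show ?thesis using Emb_U_iff[OF B] by blast
qed

section \<open>Increasing maps into \<open>{..<N}\<close> and the restored order\<close>

definition order_maps :: "'r \<Rightarrow> ('v, 'r) rel_structure \<Rightarrow> nat \<Rightarrow> ('v \<Rightarrow> nat) set" where
  "order_maps lt M N = {f \<in> verts M \<rightarrow>\<^sub>E {..<N}.
     \<forall>x \<in> verts M. \<forall>y \<in> verts M. [x, y] \<in> rel M lt \<longleftrightarrow> f x < f y}"

lemma order_mapsD:
  assumes "f \<in> order_maps lt M N"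
  shows "f \<in> verts M \<rightarrow>\<^sub>E {..<N}"
    "\<And>x y. x \<in> verts M \<Longrightarrow> y \<in> verts M \<Longrightarrow> [x, y] \<in> rel M lt \<longleftrightarrow> f x < f y"
  using assms by (auto simp: order_maps_def)

lemma ordered_structureD:
  assumes "ordered_structure lt M"
  shows "[x, x] \<notin> rel M lt" "[x, y] \<in> rel M lt \<Longrightarrow> [y, z] \<in> rel M lt \<Longrightarrow> [x, z] \<in> rel M lt"
    "x \<in> verts M \<Longrightarrow> y \<in> verts M \<Longrightarrow> x \<noteq> y \<Longrightarrow> [x, y] \<in> rel M lt \<or> [y, x] \<in> rel M lt"
  using assms unfolding ordered_structure_def strict_linear_order_on_def trans_def irrefl_def total_on_def
  by blast+

lemma order_maps_inj:
  assumes "ordered_structure lt M" "f \<in> order_maps lt M N"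
  shows "inj_on f (verts M)"
proof (rule inj_onI, rule ccontr)
  fix x y assume "x \<in> verts M" "y \<in> verts M" "f x = f y" "x \<noteq> y"
  then show False
    using ordered_structureD(3)[OF assms(1), of x y] order_mapsD(2)[OF assms(2)] by auto
qed

text \<open>The value at \<open>x\<close> is the element of the image with as many smaller elements
  as \<open>x\<close> has predecessors. So increasing maps can be replaced by their images when
  colouring.\<close>

lemma order_maps_unique:
  assumes f: "f \<in> order_maps lt M N" and g: "g \<in> order_maps lt M N"
    and im: "f ` verts M = g ` verts M" and M: "ordered_structure lt M" "finite (verts M)"
  shows "f = g"
proof (rule PiE_ext[OF order_mapsD(1)[OF f] order_mapsD(1)[OF g]])
  fix x assume x: "x \<in> verts M"
  let ?H = "f ` verts M"
  have rank: "card {h \<in> k ` verts M. h < k x} = card {y \<in> verts M. [y, x] \<in> rel M lt}"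
    if k: "k \<in> order_maps lt M N" for k
  proof -
    have "{h \<in> k ` verts M. h < k x} = k ` {y \<in> verts M. [y, x] \<in> rel M lt}"
      using order_mapsD(2)[OF k _ x] by blast
    moreover have "inj_on k {y \<in> verts M. [y, x] \<in> rel M lt}"
      by (rule inj_on_subset[OF order_maps_inj[OF M(1) k]]) auto
    ultimately show ?thesis by (simp add: card_image)
  qed
  have eq: "card {h \<in> ?H. h < f x} = card {h \<in> ?H. h < g x}"
    using rank[OF f] rank[OF g] im by simp
  have fin: "finite ?H" using M(2) by simp
  have lt: "card {h \<in> ?H. h < a} < card {h \<in> ?H. h < b}" if "a < b" "a \<in> ?H" for a b
    by (rule psubset_card_mono) (use fin that in auto)
  have "f x \<in> ?H" "g x \<in> ?H" using x im by auto
  then show "f x = g x" using lt[of "f x" "g x"] lt[of "g x" "f x"] eq by (metis less_irrefl linorder_neqE)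
qed

text \<open>A vertex with \<open>r\<close> predecessors goes to entry \<open>r\<close>, counted from
  0, of the sorted list of \<open>H\<close>.\<close>

lemma order_maps_exists:
  assumes M: "ordered_structure lt M" "finite (verts M)"
    and H: "H \<subseteq> {..<N}" "card H = card (verts M)"
  shows "\<exists>f \<in> order_maps lt M N. f ` verts M = H"
proof -
  define r where "r = (\<lambda>x. card {y \<in> verts M. [y, x] \<in> rel M lt})"
  define s where "s = sorted_list_of_set H"
  have finH: "finite H" using H(1) finite_subset by blast
  have s: "length s = card (verts M)" "set s = H" "sorted_wrt (<) s"
    using finH H(2) by (auto simp: s_def)
  have r_less: "r x < r y" if "x \<in> verts M" "[x, y] \<in> rel M lt" for x y
    unfolding r_def
  proof (rule psubset_card_mono)
    show "{z \<in> verts M. [z, x] \<in> rel M lt} \<subset> {z \<in> verts M. [z, y] \<in> rel M lt}"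
      using that ordered_structureD[OF M(1)] by blast
  qed (use M in auto)
  have r_bound: "r x < length s" if "x \<in> verts M" for x
    unfolding r_def s(1)
  proof (rule psubset_card_mono)
    show "{y \<in> verts M. [y, x] \<in> rel M lt} \<subset> verts M"
      using that ordered_structureD(1)[OF M(1)] by blast
  qed (use M in auto)
  define f where "f = (\<lambda>x \<in> verts M. s ! r x)"
  have f_less: "f x < f y" if "x \<in> verts M" "y \<in> verts M" "[x, y] \<in> rel M lt" for x y
    using that r_less[OF that(1,3)] r_bound s(3) by (simp add: f_def sorted_wrt_nth_less)
  have fH: "f ` verts M \<subseteq> H" using r_bound s(2) nth_mem by (fastforce simp: f_def)
  have f: "f \<in> order_maps lt M N"
    unfolding order_maps_def
  proof (intro CollectI conjI ballI)
    show "f \<in> verts M \<rightarrow>\<^sub>E {..<N}" using fH H(1) by (auto simp: f_def)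
    show "[x, y] \<in> rel M lt \<longleftrightarrow> f x < f y" if "x \<in> verts M" "y \<in> verts M" for x y
      using f_less[OF that] f_less[OF that(2,1)] ordered_structureD(3)[OF M(1) that] by force
  qed
  have "card (f ` verts M) = card H" using card_image[OF order_maps_inj[OF M(1) f]] H(2) by simp
  then have "f ` verts M = H" using card_subset_eq[OF finH fH] by simp
  then show ?thesis using f by blast
qed

text \<open>The projection need not be injective on \<open>P\<close>; comparing vertices as numbers
  inside its fibres makes the order linear.\<close>

definition add_order :: "'r \<Rightarrow> (nat, 'r) rel_structure \<Rightarrow> (nat \<Rightarrow> nat) \<Rightarrow> (nat, 'r) rel_structure" where
  "add_order lt P p = \<lparr>verts = verts P, rel = (rel P)(lt :=
     {[u, v] | u v. u \<in> verts P \<and> v \<in> verts P \<and> (p u < p v \<or> p u = p v \<and> u < v)})\<rparr>"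

text \<open>The partite construction runs without the order symbol. The projection remembers the
  order, and \<open>add_order\<close> restores it.\<close>

definition reduct :: "'r rel_language \<Rightarrow> 'r \<Rightarrow> 'r rel_language" where
  "reduct L lt = L\<lparr>symbols := symbols L - {lt}\<rparr>"

lemma reduct_simps [simp]:
  "symbols (reduct L lt) = symbols L - {lt}" "arity (reduct L lt) = arity L"
  by (simp_all add: reduct_def)

lemma L_structure_reduct: "L_structure L M \<Longrightarrow> L_structure (reduct L lt) M"
  by (simp add: L_structure_def)

lemma add_order_finite_ordered:
  assumes "L_structure (reduct L lt) P" "finite (verts P)" "arity L lt = 2"
  shows "add_order lt P p \<in> finite_ordered_structures L lt"
proof -
  have "L_structure L (add_order lt P p)"
    using assms by (auto simp: L_structure_def add_order_def tuples_def)
  moreover have "ordered_structure lt (add_order lt P p)"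
    unfolding ordered_structure_def strict_linear_order_on_def trans_def irrefl_def total_on_def
    by (auto simp: add_order_def)
  ultimately show ?thesis using assms(2) by (simp add: finite_ordered_structures_def add_order_def)
qed

lemma Emb_U_add_order:
  assumes M: "L_structure L M" "ordered_structure lt M" and lt: "arity L lt = 2" "lt \<notin> U"
    and f: "f \<in> Emb_U (reduct L lt) U M P"
    and ord: "\<And>x y. x \<in> verts M \<Longrightarrow> y \<in> verts M \<Longrightarrow> [x, y] \<in> rel M lt \<longleftrightarrow> p (f x) < p (f y)"
  shows "f \<in> Emb_U L U M (add_order lt P p)"
proof -
  have f': "f \<in> Emb (reduct L lt) M P" "U_closed U P (f ` verts M)"
    using f Emb_U_iff[OF L_structure_reduct[OF M(1)]] by blast+
  have "f \<in> Emb L M (add_order lt P p)"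
  proof (rule EmbI)
    show "f \<in> verts M \<rightarrow>\<^sub>E verts (add_order lt P p)" "inj_on f (verts M)"
      using EmbD[OF f'(1)] by (auto simp: add_order_def)
    fix R xs assume R: "R \<in> symbols L" and xs: "set xs \<subseteq> verts M" "length xs = arity L R"
    show "xs \<in> rel M R \<longleftrightarrow> map f xs \<in> rel (add_order lt P p) R"
    proof (cases "R = lt")
      case True
      then obtain x y where xy: "xs = [x, y]" using xs(2) lt(1)
        by (auto simp: numeral_2_eq_2 length_Suc_conv)
      then have V: "x \<in> verts M" "y \<in> verts M" using xs by auto
      \<comment> \<open>Equal projections force \<open>x = y\<close> by totality, so ties are never
        decided inside the image of \<open>M\<close>.\<close>
      have "\<not> (p (f x) = p (f y) \<and> f x < f y)"
        using ordered_structureD(3)[OF M(2) V] ord[OF V] ord[OF V(2,1)] by auto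
      then show ?thesis using xy True V ord[OF V] EmbD(3)[OF f'(1)] by (auto simp: add_order_def)
    next
      case False
      then show ?thesis using EmbD(4)[OF f'(1), of R xs] R xs by (simp add: add_order_def)
    qed
  qed
  moreover have "U_closed U (add_order lt P p) (f ` verts M)"
    using f'(2) lt(2) by (auto simp: U_closed_def add_order_def)
  ultimately show ?thesis using Emb_U_iff[OF M(1)] by blast
qed

section \<open>Combining Ramsey's theorem with the partite construction\<close>

theorem theoremA13:
  fixes L :: "'r rel_language" and lt :: 'r and U :: "'r set"
    and A :: "('a, 'r) rel_structure" and B :: "('b, 'r) rel_structure"
  assumes "lt \<in> symbols L" and "arity L lt = 2"
    and "U \<subseteq> symbols L - {lt}" and "\<forall>R \<in> U. arity L R \<ge> 2"
    and "A \<in> finite_ordered_structures L lt"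
    and "B \<in> finite_ordered_structures L lt"
  shows "\<exists>C :: (nat, 'r) rel_structure.
           C \<in> finite_ordered_structures L lt \<and> U_arrow L U C B A"
proof -
  let ?L = "reduct L lt"
  have U: "U \<subseteq> symbols ?L" "U \<subseteq> symbols L" "lt \<notin> U" "\<forall>R \<in> U. arity ?L R \<ge> 2" using assms by auto
  have A: "L_structure L A" "finite (verts A)" "ordered_structure lt A" "L_structure ?L A"
    and B: "L_structure L B" "finite (verts B)" "ordered_structure lt B" "L_structure ?L B"
    using assms(5,6) L_structure_reduct by (auto simp: finite_ordered_structures_def)
  obtain N :: nat where N: "partn_lst {..<N} [card (verts B), card (verts B)] (card (verts A))"
    using ramsey_full by blast
  define F where "F = order_maps lt A N"
  define T where "T = order_maps lt B N"
  have "finite F" "finite T" unfolding F_def T_def order_maps_def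
    by (auto intro: finite_subset[OF _ finite_PiE[of "verts A" "\<lambda>_. {..<N}"]]
        finite_subset[OF _ finite_PiE[of "verts B" "\<lambda>_. {..<N}"]] simp: A B)
  define P0 where "P0 = copies_union T B"
  define p0 where "p0 = (\<lambda>(\<beta> :: 'b \<Rightarrow> nat, b). \<beta> b)"
  have P0: "L_structure ?L P0" "finite (verts P0)"
    using L_structure_copies_union[OF B(4)] \<open>finite T\<close> B(2) by (auto simp: P0_def copies_union_def)
  have F_inj: "inj_on \<alpha> (verts A)" if "\<alpha> \<in> F" for \<alpha>
    using order_maps_inj[OF A(3)] that by (simp add: F_def)
  from partite_iterate[OF U(1) A(4,2) P0 \<open>finite F\<close> F_inj, of p0]
  obtain P :: "(nat, 'r) rel_structure" and p where P: "L_structure ?L P" "finite (verts P)"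
    and ram: "\<And>\<chi> :: ('a \<Rightarrow> nat) \<Rightarrow> bool. \<exists>e \<in> Emb_U ?L U P0 P. (\<forall>v \<in> verts P0. p (e v) = p0 v) \<and>
      (\<forall>\<alpha> \<in> F. \<exists>c. \<forall>g \<in> copies_over ?L U A P0 p0 \<alpha>. \<chi> (compose (verts A) e g) = c)" by auto
  define C where "C = add_order lt P p"
  have C: "C \<in> finite_ordered_structures L lt"
    unfolding C_def by (rule add_order_finite_ordered[OF P assms(2)])
  have strC: "L_structure L C" using C by (simp add: finite_ordered_structures_def)
  have "\<exists>f \<in> Emb_U L U B C. \<exists>c. \<forall>e \<in> Emb_U L U A B. \<chi> (compose (verts A) f e) = c"
    if \<chi>: "\<chi> \<in> Emb_U L U A C \<rightarrow> {0, 1 :: nat}" for \<chi>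
  proof -
    from ram[of "\<lambda>g. \<chi> g = 1"] obtain e where e: "e \<in> Emb_U ?L U P0 P"
      and pe: "\<And>v. v \<in> verts P0 \<Longrightarrow> p (e v) = p0 v"
      and "\<forall>\<alpha> \<in> F. \<exists>c. \<forall>g \<in> copies_over ?L U A P0 p0 \<alpha>. (\<chi> (compose (verts A) e g) = 1) = c"
      by blast
    then obtain c where c: "\<And>\<alpha> g. \<alpha> \<in> F \<Longrightarrow> g \<in> copies_over ?L U A P0 p0 \<alpha> \<Longrightarrow>
      (\<chi> (compose (verts A) e g) = 1) = c \<alpha>" by metis
    define col where "col = (\<lambda>Y. if \<exists>\<alpha> \<in> F. \<alpha> ` verts A = Y \<and> c \<alpha> then 1 else 0 :: nat)"
    have col: "(col (\<alpha> ` verts A) = 1) = c \<alpha>" if "\<alpha> \<in> F" for \<alpha>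
      using that order_maps_unique[OF _ _ _ A(3,2)] unfolding col_def F_def by auto
    have "col \<in> [{..<N}]\<^bsup>card (verts A)\<^esup> \<rightarrow> {..<length [card (verts B), card (verts B)]}"
      by (auto simp: col_def)
    with N obtain i where "i < 2" "monochromatic {..<N} (card (verts B)) (card (verts A)) col i"
      unfolding partn_lst_def by (fastforce simp: less_Suc_eq numeral_2_eq_2)
    then obtain H where H: "H \<in> [{..<N}]\<^bsup>card (verts B)\<^esup>" "col ` [H]\<^bsup>card (verts A)\<^esup> \<subseteq> {i}"
      unfolding monochromatic_def by blast
    \<comment> \<open>The increasing map onto the homogeneous set \<open>H\<close> selects the
      initial copy of \<open>B\<close> that becomes the required one.\<close>
    obtain \<beta> where \<beta>: "\<beta> \<in> T" "\<beta> ` verts B = H"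
      using order_maps_exists[OF B(3,2), of H N] H(1) by (auto simp: T_def nsets_def)
    let ?i = "\<lambda>b \<in> verts B. (\<beta>, b)"
    have i: "?i \<in> Emb_U ?L U B P0"
      unfolding P0_def by (rule copies_union_inclusion[OF B(4) U(1,4) \<beta>(1)])
    let ?f = "compose (verts B) e ?i"
    have f': "?f \<in> Emb_U ?L U B P" by (rule compose_Emb_U[OF U(1) B(4) P0(1) P(1) i e])
    have pf: "p (?f b) = \<beta> b" if "b \<in> verts B" for b
      using pe[of "(\<beta>, b)"] that \<beta>(1) by (simp add: compose_def P0_def copies_union_def p0_def)
    have f: "?f \<in> Emb_U L U B C"
      unfolding C_def using pf order_mapsD(2)[OF \<beta>(1)[unfolded T_def]]
      by (intro Emb_U_add_order[OF B(1,3) assms(2) U(3) f']) simp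
    have "\<chi> (compose (verts A) ?f g) = of_bool (i = 1)" if g: "g \<in> Emb_U L U A B" for g
    proof -
      have gE: "g \<in> Emb L A B" "U_closed U B (g ` verts A)" using g Emb_U_iff[OF A(1)] by blast+
      have g': "g \<in> Emb_U ?L U A B" using gE Emb_U_iff[OF A(4)] by (auto simp: Emb_def)
      \<comment> \<open>The copy \<open>g\<close> inside the copy \<open>\<beta>\<close> of
        \<open>B\<close> lies over \<open>\<beta> \<circ> g\<close>, whose image is a subset of
        \<open>H\<close> and hence has colour \<open>i\<close>.\<close>
      define \<alpha> where "\<alpha> = compose (verts A) \<beta> g"
      have "[x, y] \<in> rel A lt \<longleftrightarrow> \<beta> (g x) < \<beta> (g y)" if "x \<in> verts A" "y \<in> verts A" for x y
        using EmbD(4)[OF gE(1) assms(1), of "[x, y]"] that assms(2)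
          order_mapsD(2)[OF \<beta>(1)[unfolded T_def]] EmbD(3)[OF gE(1)] by simp
      then have \<alpha>F: "\<alpha> \<in> F"
        using order_mapsD(1)[OF \<beta>(1)[unfolded T_def]] EmbD(3)[OF gE(1)]
        by (auto simp: F_def order_maps_def \<alpha>_def compose_def)
      have "\<alpha> ` verts A \<subseteq> H" using \<beta>(2) EmbD(3)[OF gE(1)] by (auto simp: \<alpha>_def compose_def)
      then have "\<alpha> ` verts A \<in> [H]\<^bsup>card (verts A)\<^esup>"
        using A(2) card_image[OF F_inj[OF \<alpha>F]] by (simp add: nsets_def)
      then have "col (\<alpha> ` verts A) = i" using H(2) by blast
      then have ci: "c \<alpha> = (i = 1)" using col[OF \<alpha>F] by simp
      let ?g = "compose (verts A) ?i g"
      have "?g \<in> Emb_U ?L U A P0" by (rule compose_Emb_U[OF U(1) A(4) B(4) P0(1) g' i])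
      then have "?g \<in> copies_over ?L U A P0 p0 \<alpha>"
        using EmbD(3)[OF gE(1)] by (simp add: copies_over_def compose_def \<alpha>_def p0_def)
      from c[OF \<alpha>F this] have "(\<chi> (compose (verts A) e ?g) = 1) = (i = 1)" using ci by simp
      moreover have "compose (verts A) e ?g = compose (verts A) ?f g"
        using EmbD(1)[OF gE(1)] by (intro compose_assoc) auto
      moreover have "compose (verts A) ?f g \<in> Emb_U L U A C"
        by (rule compose_Emb_U[OF U(2) A(1) B(1) strC g f])
      ultimately show ?thesis using \<chi> by fastforce
    qed
    then show ?thesis using f by blast
  qed
  then show ?thesis using C unfolding U_arrow_def by blast
qed

end
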